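(* Let $q\ge 43$ be the order of a projective $3$-space $\mathrm{PG}(3,q)$ and let $\Gamma$ be the graph whose vertices are the chambers of $\mathrm{PG}(3,q)$, two vertices being adjacent when the corresponding chambers are opposite (in general position). Then: (a) The largest independent sets of $\Gamma$ are exactly the sets $F(x)$ where $x$ is a point or a plane of $\mathrm{PG}(3,q)$. (b) Every maximal independent set of $\Gamma$ that is not of the form $F(x)$ for a point or plane $x$ has at most $9(q+1)(5q^2+1)$ elements. (c) If $q\ge 47$, then the chromatic number of $\Gamma$ is $q^2+q$.
   Context: A chamber of $\mathrm{PG}(3,q)$ is a triple $\{P,\ell,\pi\}$ consisting of a point $P$, a line $\ell$ and a plane $\pi$ that are mutually incident. Two chambers $\{P,\ell,\pi\}$ and $\{P',\ell',\pi'\}$ are opposite if $P\notin\pi'$, $\ell$ and $\ell'$ are skew (disjoint), and $P'\notin\pi$. For a point or a plane $x$, $F(x)$ denotes the set of all chambers whose line is incident with $x$ (i.e. contains the point $x$, resp. lies in the plane $x$); each such set is independent in $\Gamma$ and has $(q^2+q+1)(q+1)^2$ elements. *)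

theory Defs
  imports "HOL-Analysis.Analysis"
begin

section \<open>Independent sets and chromatic number\<close>

text \<open>A simple graph is given by its vertex set \<open>V\<close> and an adjacency relation \<open>adj\<close> that is
  symmetric and irreflexive on \<open>V\<close>.\<close>

definition independent_set :: "'v set \<Rightarrow> ('v \<Rightarrow> 'v \<Rightarrow> bool) \<Rightarrow> 'v set \<Rightarrow> bool" where
  "independent_set V adj S \<longleftrightarrow> S \<subseteq> V \<and> (\<forall>u\<in>S. \<forall>v\<in>S. \<not> adj u v)"

text \<open>Maximal means maximal with respect to inclusion, largest means of maximum cardinality;
  both are meant for a finite \<open>V\<close>.\<close>

definition maximal_independent_set :: "'v set \<Rightarrow> ('v \<Rightarrow> 'v \<Rightarrow> bool) \<Rightarrow> 'v set \<Rightarrow> bool" where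
  "maximal_independent_set V adj S \<longleftrightarrow>
     independent_set V adj S \<and> (\<forall>T. independent_set V adj T \<and> S \<subseteq> T \<longrightarrow> T = S)"

definition largest_independent_set :: "'v set \<Rightarrow> ('v \<Rightarrow> 'v \<Rightarrow> bool) \<Rightarrow> 'v set \<Rightarrow> bool" where
  "largest_independent_set V adj S \<longleftrightarrow>
     independent_set V adj S \<and> (\<forall>T. independent_set V adj T \<longrightarrow> card T \<le> card S)"

definition proper_colouring ::
    "'v set \<Rightarrow> ('v \<Rightarrow> 'v \<Rightarrow> bool) \<Rightarrow> nat \<Rightarrow> ('v \<Rightarrow> nat) \<Rightarrow> bool" where
  "proper_colouring V adj k c \<longleftrightarrow>
     (\<forall>v\<in>V. c v < k) \<and> (\<forall>u\<in>V. \<forall>v\<in>V. adj u v \<longrightarrow> c u \<noteq> c v)"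

definition chromatic_number :: "'v set \<Rightarrow> ('v \<Rightarrow> 'v \<Rightarrow> bool) \<Rightarrow> nat" where
  "chromatic_number V adj = (LEAST k. \<exists>c. proper_colouring V adj k c)"


section \<open>Projective 3-space over a finite field\<close>

text \<open>\<open>PG(3,q)\<close> is the lattice of subspaces of \<open>'a ^ 4\<close>, where \<open>'a\<close> is a field with \<open>q\<close> elements.
  Points, lines and planes are the subspaces of vector space dimension 1, 2 and 3, and incidence
  is inclusion, in either direction.\<close>

type_synonym 'a flat = "('a ^ 4) set"

definition pg_point :: "'a::field flat \<Rightarrow> bool" where
  "pg_point P \<longleftrightarrow> vec.subspace P \<and> vec.dim P = 1"

definition pg_line :: "'a::field flat \<Rightarrow> bool" where
  "pg_line l \<longleftrightarrow> vec.subspace l \<and> vec.dim l = 2"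

definition pg_plane :: "'a::field flat \<Rightarrow> bool" where
  "pg_plane \<pi> \<longleftrightarrow> vec.subspace \<pi> \<and> vec.dim \<pi> = 3"

definition incident :: "'a flat \<Rightarrow> 'a flat \<Rightarrow> bool" where
  "incident x y \<longleftrightarrow> x \<subseteq> y \<or> y \<subseteq> x"

text \<open>Two lines are skew if they have no projective point in common, so as subspaces they meet
  exactly in the zero vector.\<close>

definition skew :: "'a::zero flat \<Rightarrow> 'a flat \<Rightarrow> bool" where
  "skew l l' \<longleftrightarrow> l \<inter> l' = {0}"


section \<open>Chambers\<close>

text \<open>As the dimensions determine which member of a chamber is the point, the line and the plane,
  the unordered triple is represented by the ordered triple (point, line, plane).\<close>

type_synonym 'a chamber = "'a flat \<times> 'a flat \<times> 'a flat"

definition chambers :: "'a::field chamber set" where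
  "chambers = {(P, l, \<pi>). pg_point P \<and> pg_line l \<and> pg_plane \<pi> \<and>
     incident P l \<and> incident l \<pi> \<and> incident P \<pi>}"

fun opposite :: "'a::zero chamber \<Rightarrow> 'a chamber \<Rightarrow> bool" where
  "opposite (P, l, \<pi>) (P', l', \<pi>') \<longleftrightarrow>
     \<not> incident P \<pi>' \<and> skew l l' \<and> \<not> incident P' \<pi>"

definition chambers_on :: "'a::field flat \<Rightarrow> 'a chamber set" where
  "chambers_on x = {(P, l, \<pi>) \<in> chambers. incident x l}"

lemma opposite_sym: "opposite c d \<Longrightarrow> opposite d c"
  by (cases c; cases d) (auto simp: skew_def)

lemma opposite_irrefl: "c \<in> chambers \<Longrightarrow> \<not> opposite c c"
  by (auto simp: chambers_def)

lemma finite_chambers: "finite (chambers :: 'a::{field,finite} chamber set)"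
  by (rule finite)

end

theory Submission
  imports Defs
begin

text \<open>
  Let \<open>F\<close> be an independent set not contained in any \<open>F(x)\<close>. If more than \<open>2(q+1)\<^sup>2\<close> chambers of \<open>F\<close> share
  a point \<open>P\<close>, then projecting to the quotient plane at \<open>P\<close> shows that every plane occurring in \<open>F\<close>
  contains \<open>P\<close>; likewise a line carrying more than \<open>2(q+1)\<close> chambers meets every line occurring in \<open>F\<close>.
  Hence such heavy points, planes and lines account for only \<open>O(q\<^sup>3)\<close> chambers. For the remaining \<open>m\<close>
  chambers any two satisfy \<open>P \<in> \<pi>'\<close>, \<open>P' \<in> \<pi>\<close> or \<open>l\<close> meets \<open>l'\<close>, but by a variance
  (expander mixing) argument only about \<open>3m\<^sup>2/q + O(q\<^sup>3 m)\<close> pairs do, whence \<open>m = O(q\<^sup>3)\<close>.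
  Altogether \<open>|F| \<le> 11q(q+1)\<^sup>2\<close>, well below \<open>|F(x)|\<close> and below the bound in (b).

  For the chromatic number, suppose that \<open>a\<close> points, \<open>b\<close> planes and \<open>s\<close> small classes are used with
  \<open>a + b + s = q\<^sup>2 + q - 1\<close>. The small classes can only take care of \<open>11qs\<close> lines. If no line were left
  uncovered, every unused point would lie on at least \<open>\<lceil>(b+1+s)/q\<rceil>\<close> of the planes, and double counting
  forces the residue of \<open>b+1+s\<close> modulo \<open>q\<close> to be at least about \<open>3q/4\<close>; the same holds dually for
  \<open>a+1+s\<close>, although the two numbers add up to \<open>s+1\<close> modulo \<open>q\<close>, where \<open>s < q/2\<close>. The argument is
  robust enough to tolerate \<open>11qs\<close> uncovered lines.
\<close>

section \<open>Axiomatic projective 3-spaces\<close>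

lemma card_fibres:
  assumes "finite A" "finite B" "f ` A \<subseteq> B" "\<And>y. y \<in> B \<Longrightarrow> card {x \<in> A. f x = y} = k"
  shows "card A = card B * k"
proof -
  have "card A = (\<Sum>y\<in>B. card {x \<in> A. f x = y})"
    using sum_fun_comp[OF assms(1,2,3), of "\<lambda>_. 1::nat"] by simp
  then show ?thesis using assms(4) by simp
qed

lemma card_fibres_le:
  assumes "finite A" "finite B" "f ` A \<subseteq> B" "\<And>y. y \<in> B \<Longrightarrow> card {x \<in> A. f x = y} \<le> k"
  shows "card A \<le> card B * k"
proof -
  have "card A = (\<Sum>y\<in>B. card {x \<in> A. f x = y})"
    using sum_fun_comp[OF assms(1,2,3), of "\<lambda>_. 1::nat"] by simp
  also have "\<dots> \<le> card B * k" using sum_bounded_above[of B "\<lambda>y. card {x \<in> A. f x = y}" k] assms(4) by simp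
  finally show ?thesis .
qed

lemma sum_card_swap:
  assumes "finite A" "finite B"
  shows "(\<Sum>x\<in>A. card {y\<in>B. R x y}) = (\<Sum>y\<in>B. card {x\<in>A. R x y})"
proof -
  have "(\<Sum>x\<in>A. card {y\<in>B. R x y}) = (\<Sum>x\<in>A. \<Sum>y\<in>B. if R x y then 1 else 0)"
    using assms(2) by (simp add: sum.If_cases Int_def)
  also have "\<dots> = (\<Sum>y\<in>B. \<Sum>x\<in>A. if R x y then 1 else 0)" by (rule sum.swap)
  also have "\<dots> = (\<Sum>y\<in>B. card {x\<in>A. R x y})"
    using assms(1) by (simp add: sum.If_cases Int_def)
  finally show ?thesis .
qed

text \<open>Points, lines and planes share one type and one relation, so that reversing
  \<open>\<sqsubseteq>\<close> and exchanging \<open>Pt\<close> with \<open>Pl\<close> can yield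
  another instance. Only the numbers of points are assumed; those of lines and planes are
  derived.\<close>

locale pg3 =
  fixes Pt Ln Pl :: "'f set" and le :: "'f \<Rightarrow> 'f \<Rightarrow> bool" (infix "\<sqsubseteq>" 50) and q :: nat
  assumes finite_Pt: "finite Pt" and finite_Ln: "finite Ln" and finite_Pl: "finite Pl"
    and q2: "q \<ge> 2"
    and le_trans: "\<And>P l h. P \<sqsubseteq> l \<Longrightarrow> l \<sqsubseteq> h \<Longrightarrow> P \<sqsubseteq> h"
    and line_ex: "\<And>P Q. P \<in> Pt \<Longrightarrow> Q \<in> Pt \<Longrightarrow> P \<noteq> Q \<Longrightarrow> \<exists>l\<in>Ln. P \<sqsubseteq> l \<and> Q \<sqsubseteq> l"
    and line_unique: "\<And>P Q l l'. P \<in> Pt \<Longrightarrow> Q \<in> Pt \<Longrightarrow> P \<noteq> Q \<Longrightarrow> l \<in> Ln \<Longrightarrow> l' \<in> Ln \<Longrightarrow>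
      P \<sqsubseteq> l \<Longrightarrow> Q \<sqsubseteq> l \<Longrightarrow> P \<sqsubseteq> l' \<Longrightarrow> Q \<sqsubseteq> l' \<Longrightarrow> l = l'"
    and plane_ex: "\<And>P l. P \<in> Pt \<Longrightarrow> l \<in> Ln \<Longrightarrow> \<exists>h\<in>Pl. P \<sqsubseteq> h \<and> l \<sqsubseteq> h"
    and point_ex: "\<And>h l. h \<in> Pl \<Longrightarrow> l \<in> Ln \<Longrightarrow> \<exists>P\<in>Pt. P \<sqsubseteq> h \<and> P \<sqsubseteq> l"
    and line_in_plane: "\<And>P Q l h. P \<in> Pt \<Longrightarrow> Q \<in> Pt \<Longrightarrow> P \<noteq> Q \<Longrightarrow> l \<in> Ln \<Longrightarrow> h \<in> Pl \<Longrightarrow>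
      P \<sqsubseteq> l \<Longrightarrow> Q \<sqsubseteq> l \<Longrightarrow> P \<sqsubseteq> h \<Longrightarrow> Q \<sqsubseteq> h \<Longrightarrow> l \<sqsubseteq> h"
    and planes_line: "\<And>h h'. h \<in> Pl \<Longrightarrow> h' \<in> Pl \<Longrightarrow> h \<noteq> h' \<Longrightarrow> \<exists>l\<in>Ln. l \<sqsubseteq> h \<and> l \<sqsubseteq> h'"
    and point_on_line: "\<And>P l h h'. P \<in> Pt \<Longrightarrow> l \<in> Ln \<Longrightarrow> h \<in> Pl \<Longrightarrow> h' \<in> Pl \<Longrightarrow> h \<noteq> h' \<Longrightarrow>
      l \<sqsubseteq> h \<Longrightarrow> l \<sqsubseteq> h' \<Longrightarrow> P \<sqsubseteq> h \<Longrightarrow> P \<sqsubseteq> h' \<Longrightarrow> P \<sqsubseteq> l"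
    and card_Pt: "card Pt = q^3 + q\<^sup>2 + q + 1"
    and points_on_line: "\<And>l. l \<in> Ln \<Longrightarrow> card {P\<in>Pt. P \<sqsubseteq> l} = q + 1"
    and points_on_plane: "\<And>h. h \<in> Pl \<Longrightarrow> card {P\<in>Pt. P \<sqsubseteq> h} = q\<^sup>2 + q + 1"
begin

definition join where "join P Q = (SOME l. l \<in> Ln \<and> P \<sqsubseteq> l \<and> Q \<sqsubseteq> l)"

lemma join:
  assumes "P \<in> Pt" "Q \<in> Pt" "P \<noteq> Q"
  shows "join P Q \<in> Ln" "P \<sqsubseteq> join P Q" "Q \<sqsubseteq> join P Q"
  using line_ex[OF assms] unfolding join_def by (metis (mono_tags, lifting) someI_ex)+

lemma join_eq:
  assumes "P \<in> Pt" "Q \<in> Pt" "P \<noteq> Q" "l \<in> Ln" "P \<sqsubseteq> l" "Q \<sqsubseteq> l"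
  shows "join P Q = l"
  using join[OF assms(1-3)] assms line_unique by blast

lemma point_on_line_other:
  assumes "l \<in> Ln"
  obtains Q where "Q \<in> Pt" "Q \<sqsubseteq> l" "Q \<noteq> P"
proof -
  have "card {Q\<in>Pt. Q \<sqsubseteq> l} > card {P}" using points_on_line[OF assms] q2 by simp
  then have "\<not> {Q\<in>Pt. Q \<sqsubseteq> l} \<subseteq> {P}" using card_mono[of "{P}"] by (meson finite.simps not_le)
  then show thesis using that by auto
qed

lemma two_planes_line_unique:
  assumes "h \<in> Pl" "h' \<in> Pl" "h \<noteq> h'" "l \<in> Ln" "l' \<in> Ln"
    "l \<sqsubseteq> h" "l \<sqsubseteq> h'" "l' \<sqsubseteq> h" "l' \<sqsubseteq> h'"
  shows "l = l'"
proof -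
  obtain P where P: "P \<in> Pt" "P \<sqsubseteq> l'" using point_on_line_other[OF assms(5)] by blast
  obtain Q where Q: "Q \<in> Pt" "Q \<sqsubseteq> l'" "Q \<noteq> P" using point_on_line_other[OF assms(5)] by blast
  have "P \<sqsubseteq> l" "Q \<sqsubseteq> l" using point_on_line[of _ l h h'] assms P Q le_trans by blast+
  then show ?thesis using line_unique assms P Q by metis
qed

text \<open>Joining with \<open>P\<close> splits the other \<open>q^3 + q^2 + q\<close> points into
  classes of size \<open>q\<close>, one for each line through \<open>P\<close>.\<close>

lemma lines_on_point:
  assumes P: "P \<in> Pt"
  shows "card {l\<in>Ln. P \<sqsubseteq> l} = q\<^sup>2 + q + 1"
proof -
  have "card (Pt - {P}) = card {l\<in>Ln. P \<sqsubseteq> l} * q"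
  proof (rule card_fibres[where f = "join P"])
    fix l assume l: "l \<in> {l\<in>Ln. P \<sqsubseteq> l}"
    have "{x \<in> Pt - {P}. join P x = l} = {Q\<in>Pt. Q \<sqsubseteq> l} - {P}"
      using l P join(3)[OF P] join_eq[OF P] by blast
    then show "card {x \<in> Pt - {P}. join P x = l} = q"
      using l P points_on_line by simp
  next
    show "join P ` (Pt - {P}) \<subseteq> {l\<in>Ln. P \<sqsubseteq> l}" using join[OF P] by blast
  qed (use finite_Pt finite_Ln in auto)
  moreover have "card (Pt - {P}) = q^3 + q\<^sup>2 + q" using P card_Pt by simp
  ultimately have "card {l\<in>Ln. P \<sqsubseteq> l} * q = (q\<^sup>2 + q + 1) * q"
    by (simp add: algebra_simps power2_eq_square power3_eq_cube)
  moreover have "q \<noteq> 0" using q2 by simp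
  ultimately show ?thesis by (metis mult_right_cancel)
qed

lemma lines_on_flag:
  assumes P: "P \<in> Pt" and h: "h \<in> Pl" "P \<sqsubseteq> h"
  shows "card {l\<in>Ln. P \<sqsubseteq> l \<and> l \<sqsubseteq> h} = q + 1"
proof -
  have "card ({Q\<in>Pt. Q \<sqsubseteq> h} - {P}) = card {l\<in>Ln. P \<sqsubseteq> l \<and> l \<sqsubseteq> h} * q"
  proof (rule card_fibres[where f = "join P"])
    fix l assume l: "l \<in> {l\<in>Ln. P \<sqsubseteq> l \<and> l \<sqsubseteq> h}"
    have "{x \<in> {Q\<in>Pt. Q \<sqsubseteq> h} - {P}. join P x = l} = {Q\<in>Pt. Q \<sqsubseteq> l} - {P}"
    proof (intro equalityI subsetI)
      fix Q assume "Q \<in> {x \<in> {Q\<in>Pt. Q \<sqsubseteq> h} - {P}. join P x = l}"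
      then show "Q \<in> {Q\<in>Pt. Q \<sqsubseteq> l} - {P}" using join(3)[OF P] by blast
    next
      fix Q assume "Q \<in> {Q\<in>Pt. Q \<sqsubseteq> l} - {P}"
      moreover from this have "Q \<sqsubseteq> h" using l le_trans by blast
      ultimately show "Q \<in> {x \<in> {Q\<in>Pt. Q \<sqsubseteq> h} - {P}. join P x = l}"
        using l P join_eq[OF P] by blast
    qed
    then show "card {x \<in> {Q\<in>Pt. Q \<sqsubseteq> h} - {P}. join P x = l} = q"
      using l P points_on_line by simp
  next
    show "join P ` ({Q\<in>Pt. Q \<sqsubseteq> h} - {P}) \<subseteq> {l\<in>Ln. P \<sqsubseteq> l \<and> l \<sqsubseteq> h}"
      using join[OF P] line_in_plane[OF P] h by blast
  qed (use finite_Pt finite_Ln in auto)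
  moreover have "card ({Q\<in>Pt. Q \<sqsubseteq> h} - {P}) = q\<^sup>2 + q" using P h points_on_plane by simp
  ultimately have "card {l\<in>Ln. P \<sqsubseteq> l \<and> l \<sqsubseteq> h} * q = (q + 1) * q"
    by (simp add: algebra_simps power2_eq_square)
  moreover have "q \<noteq> 0" using q2 by simp
  ultimately show ?thesis by (metis mult_right_cancel)
qed

lemma plane_unique:
  assumes "P \<in> Pt" "l \<in> Ln" "\<not> P \<sqsubseteq> l" "h \<in> Pl" "h' \<in> Pl" "P \<sqsubseteq> h" "P \<sqsubseteq> h'" "l \<sqsubseteq> h" "l \<sqsubseteq> h'"
  shows "h = h'"
  using assms point_on_line by blast

text \<open>The planes through \<open>l\<close> partition the \<open>q^3 + q^2\<close> points off
  \<open>l\<close>, each taking \<open>q^2\<close> of them.\<close>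

lemma planes_on_line:
  assumes l: "l \<in> Ln"
  shows "card {h\<in>Pl. l \<sqsubseteq> h} = q + 1"
proof -
  define f where "f P = (SOME h. h \<in> Pl \<and> P \<sqsubseteq> h \<and> l \<sqsubseteq> h)" for P
  have f: "f P \<in> Pl \<and> P \<sqsubseteq> f P \<and> l \<sqsubseteq> f P" if "P \<in> Pt" for P
    unfolding f_def using plane_ex[OF that l] by (metis (mono_tags, lifting) someI_ex)
  have sub: "{P\<in>Pt. P \<sqsubseteq> l} \<subseteq> Pt" "finite {P\<in>Pt. P \<sqsubseteq> l}" using finite_Pt by auto
  have "card (Pt - {P\<in>Pt. P \<sqsubseteq> l}) = card {h\<in>Pl. l \<sqsubseteq> h} * q\<^sup>2"
  proof (rule card_fibres[where f = f])
    fix h assume h: "h \<in> {h\<in>Pl. l \<sqsubseteq> h}"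
    have "{x \<in> Pt - {P\<in>Pt. P \<sqsubseteq> l}. f x = h} = {P\<in>Pt. P \<sqsubseteq> h} - {P\<in>Pt. P \<sqsubseteq> l}"
      using h l f plane_unique by auto
    moreover have "{P\<in>Pt. P \<sqsubseteq> l} \<subseteq> {P\<in>Pt. P \<sqsubseteq> h}" using h le_trans by auto
    ultimately show "card {x \<in> Pt - {P\<in>Pt. P \<sqsubseteq> l}. f x = h} = q\<^sup>2"
      using h l points_on_line points_on_plane sub by (simp add: card_Diff_subset)
  qed (use finite_Pt finite_Pl l f in auto)
  moreover have "card (Pt - {P\<in>Pt. P \<sqsubseteq> l}) = q^3 + q\<^sup>2"
    using l points_on_line card_Pt sub by (simp add: card_Diff_subset)
  ultimately have "card {h\<in>Pl. l \<sqsubseteq> h} * q\<^sup>2 = (q + 1) * q\<^sup>2"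
    by (simp add: algebra_simps power2_eq_square power3_eq_cube)
  moreover have "q\<^sup>2 \<noteq> 0" using q2 by simp
  ultimately show ?thesis by (metis mult_right_cancel)
qed

text \<open>Incident line-plane pairs at \<open>P\<close> are counted in two ways: a line through
  \<open>P\<close> lies in \<open>q + 1\<close> planes, and a plane on \<open>P\<close> contains
  \<open>q + 1\<close> lines through \<open>P\<close>. So there are as many planes as lines on
  \<open>P\<close>.\<close>

lemma planes_on_point:
  assumes P: "P \<in> Pt"
  shows "card {h\<in>Pl. P \<sqsubseteq> h} = q\<^sup>2 + q + 1"
proof -
  have "(\<Sum>l\<in>{l\<in>Ln. P \<sqsubseteq> l}. card {h\<in>{h\<in>Pl. P \<sqsubseteq> h}. l \<sqsubseteq> h}) =
      (\<Sum>h\<in>{h\<in>Pl. P \<sqsubseteq> h}. card {l\<in>{l\<in>Ln. P \<sqsubseteq> l}. l \<sqsubseteq> h})"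
    by (rule sum_card_swap) (use finite_Ln finite_Pl in auto)
  moreover have "{h\<in>{h\<in>Pl. P \<sqsubseteq> h}. l \<sqsubseteq> h} = {h\<in>Pl. l \<sqsubseteq> h}" if "l \<in> Ln" "P \<sqsubseteq> l" for l
    using that le_trans by auto
  moreover have "{l\<in>{l\<in>Ln. P \<sqsubseteq> l}. l \<sqsubseteq> h} = {l\<in>Ln. P \<sqsubseteq> l \<and> l \<sqsubseteq> h}" for h by auto
  ultimately have "(q\<^sup>2 + q + 1) * (q + 1) = card {h\<in>Pl. P \<sqsubseteq> h} * (q + 1)"
    using P planes_on_line lines_on_flag lines_on_point by simp
  then show ?thesis by (metis mult_right_cancel add_is_0 one_neq_zero)
qed

lemma card_Pl: "card Pl = q^3 + q\<^sup>2 + q + 1"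
proof -
  have "(\<Sum>P\<in>Pt. card {h\<in>Pl. P \<sqsubseteq> h}) = (\<Sum>h\<in>Pl. card {P\<in>Pt. P \<sqsubseteq> h})"
    by (rule sum_card_swap) (use finite_Pt finite_Pl in auto)
  then have "card Pt * (q\<^sup>2 + q + 1) = card Pl * (q\<^sup>2 + q + 1)"
    using planes_on_point points_on_plane by simp
  then show ?thesis using card_Pt by (metis mult_right_cancel add_is_0 one_neq_zero)
qed

text \<open>The axioms whose duals are not themselves axioms, namely uniqueness of lines and the
  three counts, are supplied by the preceding lemmas. Interpreting this instance turns statements
  about points into statements about planes.\<close>

lemma dual: "pg3 Pl Ln Pt (\<lambda>x y. y \<sqsubseteq> x) q"
proof unfold_locales
  show "\<And>P l. P \<in> Pl \<Longrightarrow> l \<in> Ln \<Longrightarrow> \<exists>h\<in>Pt. h \<sqsubseteq> P \<and> h \<sqsubseteq> l"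
    using point_ex by blast
  show "\<And>h l. h \<in> Pt \<Longrightarrow> l \<in> Ln \<Longrightarrow> \<exists>P\<in>Pl. h \<sqsubseteq> P \<and> l \<sqsubseteq> P"
    using plane_ex by blast
  show "\<And>P Q l h. P \<in> Pl \<Longrightarrow> Q \<in> Pl \<Longrightarrow> P \<noteq> Q \<Longrightarrow> l \<in> Ln \<Longrightarrow> h \<in> Pt \<Longrightarrow>
      l \<sqsubseteq> P \<Longrightarrow> l \<sqsubseteq> Q \<Longrightarrow> h \<sqsubseteq> P \<Longrightarrow> h \<sqsubseteq> Q \<Longrightarrow> h \<sqsubseteq> l"
    using point_on_line by blast
  show "\<And>P l h h'. P \<in> Pl \<Longrightarrow> l \<in> Ln \<Longrightarrow> h \<in> Pt \<Longrightarrow> h' \<in> Pt \<Longrightarrow> h \<noteq> h' \<Longrightarrow>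
      h \<sqsubseteq> l \<Longrightarrow> h' \<sqsubseteq> l \<Longrightarrow> h \<sqsubseteq> P \<Longrightarrow> h' \<sqsubseteq> P \<Longrightarrow> l \<sqsubseteq> P"
    using line_in_plane by blast
  show "\<And>P Q l l'. P \<in> Pl \<Longrightarrow> Q \<in> Pl \<Longrightarrow> P \<noteq> Q \<Longrightarrow> l \<in> Ln \<Longrightarrow> l' \<in> Ln \<Longrightarrow>
      l \<sqsubseteq> P \<Longrightarrow> l \<sqsubseteq> Q \<Longrightarrow> l' \<sqsubseteq> P \<Longrightarrow> l' \<sqsubseteq> Q \<Longrightarrow> l = l'"
    using two_planes_line_unique by blast
  show "\<And>P l h. l \<sqsubseteq> P \<Longrightarrow> h \<sqsubseteq> l \<Longrightarrow> h \<sqsubseteq> P" using le_trans by blast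
qed (fact finite_Pt finite_Ln finite_Pl q2 card_Pl planes_on_line planes_on_point
      line_ex planes_line)+

end

section \<open>Pairwise non-opposite chambers\<close>

abbreviation pnt :: "'f \<times> 'f \<times> 'f \<Rightarrow> 'f" where "pnt c \<equiv> fst c"
abbreviation lin :: "'f \<times> 'f \<times> 'f \<Rightarrow> 'f" where "lin c \<equiv> fst (snd c)"
abbreviation pln :: "'f \<times> 'f \<times> 'f \<Rightarrow> 'f" where "pln c \<equiv> snd (snd c)"

text \<open>The passage of a chamber to the dual space, where point and plane exchange
  roles.\<close>

definition flip :: "'f \<times> 'f \<times> 'f \<Rightarrow> 'f \<times> 'f \<times> 'f" where
  "flip c = (pln c, lin c, pnt c)"

lemma flip_simps [simp]:
  "pnt (flip c) = pln c" "lin (flip c) = lin c" "pln (flip c) = pnt c"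
  by (simp_all add: flip_def)

lemma inj_flip: "inj_on flip F"
  by (auto simp: inj_on_def flip_def prod_eq_iff)

lemma card_flip [simp]: "card (flip ` F) = card F"
  by (rule card_image[OF inj_flip])

lemma card_flip_Collect: "card {c \<in> flip ` F. Q c} = card {c \<in> F. Q (flip c)}"
proof -
  have "{c \<in> flip ` F. Q c} = flip ` {c \<in> F. Q (flip c)}" by auto
  then show ?thesis by simp
qed

context pg3 begin

definition chamb where
  "chamb = {c. pnt c \<in> Pt \<and> lin c \<in> Ln \<and> pln c \<in> Pl \<and> pnt c \<sqsubseteq> lin c \<and> lin c \<sqsubseteq> pln c}"

definition meets where "meets l l' \<longleftrightarrow> (\<exists>X\<in>Pt. X \<sqsubseteq> l \<and> X \<sqsubseteq> l')"

text \<open>Independence in the opposition graph, expressed by incidence alone. Duality interchanges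
  the first two alternatives and, by \<open>meets_iff_coplanar\<close>, preserves the third.\<close>

definition crossing where
  "crossing F \<longleftrightarrow> F \<subseteq> chamb \<and>
    (\<forall>c\<in>F. \<forall>d\<in>F. pnt c \<sqsubseteq> pln d \<or> pnt d \<sqsubseteq> pln c \<or> meets (lin c) (lin d))"

lemma chambD:
  assumes "c \<in> chamb"
  shows "pnt c \<in> Pt" "lin c \<in> Ln" "pln c \<in> Pl" "pnt c \<sqsubseteq> lin c" "lin c \<sqsubseteq> pln c" "pnt c \<sqsubseteq> pln c"
  using assms le_trans unfolding chamb_def by auto

lemma finite_chamb: "finite chamb"
  by (rule finite_subset[of _ "Pt \<times> Ln \<times> Pl"])
    (auto simp: chamb_def finite_Pt finite_Ln finite_Pl)

lemma crossingD:
  assumes "crossing F" "c \<in> F"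
  shows "c \<in> chamb" "d \<in> F \<Longrightarrow> pnt c \<sqsubseteq> pln d \<or> pnt d \<sqsubseteq> pln c \<or> meets (lin c) (lin d)"
  using assms unfolding crossing_def by auto

lemma crossing_subset: "crossing F \<Longrightarrow> G \<subseteq> F \<Longrightarrow> crossing G"
  unfolding crossing_def by blast

lemma crossing_finite: "crossing F \<Longrightarrow> finite F"
  unfolding crossing_def using finite_chamb finite_subset by blast

text \<open>The plane through \<open>l\<close> and a second point of \<open>l'\<close> contains two
  points of \<open>l'\<close>, hence all of it.\<close>

lemma coplanar_if_meets:
  assumes "l \<in> Ln" "l' \<in> Ln" "meets l l'"
  shows "\<exists>h\<in>Pl. l \<sqsubseteq> h \<and> l' \<sqsubseteq> h"
proof -
  obtain X where X: "X \<in> Pt" "X \<sqsubseteq> l" "X \<sqsubseteq> l'" using assms(3) meets_def by auto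
  obtain Q where Q: "Q \<in> Pt" "Q \<sqsubseteq> l'" "Q \<noteq> X" using point_on_line_other[OF assms(2)] by blast
  obtain h where h: "h \<in> Pl" "Q \<sqsubseteq> h" "l \<sqsubseteq> h" using plane_ex[OF Q(1) assms(1)] by blast
  have "X \<sqsubseteq> h" using X h le_trans by blast
  then have "l' \<sqsubseteq> h" using line_in_plane[of X Q l' h] X Q h assms by blast
  then show ?thesis using h by blast
qed

lemma meets_iff_coplanar:
  assumes "l \<in> Ln" "l' \<in> Ln"
  shows "meets l l' \<longleftrightarrow> (\<exists>h\<in>Pl. l \<sqsubseteq> h \<and> l' \<sqsubseteq> h)"
proof
  interpret D: pg3 Pl Ln Pt "\<lambda>x y. y \<sqsubseteq> x" q by (rule dual)
  assume "\<exists>h\<in>Pl. l \<sqsubseteq> h \<and> l' \<sqsubseteq> h"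
  then show "meets l l'" using D.coplanar_if_meets[OF assms] D.meets_def meets_def by simp
qed (rule coplanar_if_meets[OF assms])

lemma flip_chamb: "pg3.chamb Pl Ln Pt (\<lambda>x y. y \<sqsubseteq> x) = flip ` chamb"
proof -
  interpret D: pg3 Pl Ln Pt "\<lambda>x y. y \<sqsubseteq> x" q by (rule dual)
  have "c \<in> flip ` chamb" if "c \<in> D.chamb" for c
  proof
    show "c = flip (flip c)" by (simp add: flip_def)
    show "flip c \<in> chamb" using that by (simp add: D.chamb_def chamb_def)
  qed
  then show ?thesis by (auto simp: D.chamb_def chamb_def)
qed

lemma crossing_dual:
  assumes "crossing F"
  shows "pg3.crossing Pl Ln Pt (\<lambda>x y. y \<sqsubseteq> x) (flip ` F)"
proof -
  interpret D: pg3 Pl Ln Pt "\<lambda>x y. y \<sqsubseteq> x" q by (rule dual)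
  have F: "F \<subseteq> chamb" using assms by (simp add: crossing_def)
  have "D.meets (lin c) (lin d) \<longleftrightarrow> meets (lin c) (lin d)" if "c \<in> F" "d \<in> F" for c d
    using meets_iff_coplanar[of "lin c" "lin d"] that F chambD(2) unfolding D.meets_def by blast
  then show ?thesis using assms F unfolding crossing_def D.crossing_def flip_chamb by auto
qed

section \<open>Numbers of chambers with prescribed elements\<close>

lemma card_chamb_point_plane:
  "card {c\<in>chamb. pnt c = P \<and> pln c = h} \<le> q + 1"
proof (cases "P \<in> Pt \<and> h \<in> Pl \<and> P \<sqsubseteq> h")
  case True
  have "card {c\<in>chamb. pnt c = P \<and> pln c = h} \<le> card {l\<in>Ln. P \<sqsubseteq> l \<and> l \<sqsubseteq> h}"
    by (rule card_inj_on_le[where f = "\<lambda>c. lin c"])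
      (auto simp: inj_on_def chamb_def finite_Ln prod_eq_iff)
  then show ?thesis using lines_on_flag True by simp
next
  case False
  then have "{c\<in>chamb. pnt c = P \<and> pln c = h} = {}" using chambD by blast
  then show ?thesis by (simp only: card.empty)
qed

lemma card_chamb_point_line:
  "card {c\<in>chamb. pnt c = P \<and> lin c = l} \<le> q + 1"
proof (cases "l \<in> Ln")
  case True
  have "card {c\<in>chamb. pnt c = P \<and> lin c = l} \<le> card {h\<in>Pl. l \<sqsubseteq> h}"
    by (rule card_inj_on_le[where f = "\<lambda>c. pln c"])
      (auto simp: inj_on_def chamb_def finite_Pl prod_eq_iff)
  then show ?thesis using planes_on_line True by simp
next
  case False
  then have "{c\<in>chamb. pnt c = P \<and> lin c = l} = {}" using chambD by blast
  then show ?thesis by (simp only: card.empty)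
qed

lemma card_chamb_line_plane:
  "card {c\<in>chamb. lin c = l \<and> pln c = h} \<le> q + 1"
proof (cases "l \<in> Ln")
  case True
  have "card {c\<in>chamb. lin c = l \<and> pln c = h} \<le> card {P\<in>Pt. P \<sqsubseteq> l}"
    by (rule card_inj_on_le[where f = "\<lambda>c. pnt c"])
      (auto simp: inj_on_def chamb_def finite_Pt prod_eq_iff)
  then show ?thesis using points_on_line True by simp
next
  case False
  then have "{c\<in>chamb. lin c = l \<and> pln c = h} = {}" using chambD by blast
  then show ?thesis by (simp only: card.empty)
qed

lemma card_chamb_line:
  assumes "l \<in> Ln"
  shows "card {c\<in>chamb. lin c = l} = (q + 1)\<^sup>2"
proof -
  have "{c\<in>chamb. lin c = l} = (\<lambda>(P, h). (P, l, h)) ` ({P\<in>Pt. P \<sqsubseteq> l} \<times> {h\<in>Pl. l \<sqsubseteq> h})"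
    using assms by (auto simp: chamb_def)
  moreover have "inj_on (\<lambda>(P, h). (P, l, h)) ({P\<in>Pt. P \<sqsubseteq> l} \<times> {h\<in>Pl. l \<sqsubseteq> h})"
    by (auto simp: inj_on_def)
  ultimately show ?thesis
    using assms by (simp add: card_image card_cartesian_product points_on_line planes_on_line power2_eq_square)
qed

lemma card_chamb_line_set:
  assumes "L \<subseteq> Ln"
  shows "card {c\<in>chamb. lin c \<in> L} = card L * (q + 1)\<^sup>2"
proof (rule card_fibres[where f = "\<lambda>c. lin c"])
  fix l assume "l \<in> L"
  moreover from this have "{c \<in> {c \<in> chamb. lin c \<in> L}. lin c = l} = {c\<in>chamb. lin c = l}" by auto
  ultimately show "card {c \<in> {c \<in> chamb. lin c \<in> L}. lin c = l} = (q + 1)\<^sup>2"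
    using card_chamb_line assms by auto
qed (use finite_chamb assms finite_Ln finite_subset in auto)

lemma card_chamb_planes:
  assumes "finite H"
  shows "card {c\<in>chamb. pnt c = P \<and> pln c \<in> H} \<le> card H * (q + 1)"
proof (rule card_fibres_le[where f = "\<lambda>c. pln c"])
  fix h
  have "card {c \<in> {c\<in>chamb. pnt c = P \<and> pln c \<in> H}. pln c = h} \<le> card {c\<in>chamb. pnt c = P \<and> pln c = h}"
    by (rule card_mono) (auto simp: finite_chamb)
  then show "card {c \<in> {c\<in>chamb. pnt c = P \<and> pln c \<in> H}. pln c = h} \<le> q + 1"
    using card_chamb_point_plane le_trans order_trans by blast
qed (use finite_chamb assms in auto)

lemma card_chamb_lines:
  assumes "finite L"
  shows "card {c\<in>chamb. pnt c = P \<and> lin c \<in> L} \<le> card L * (q + 1)"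
proof (rule card_fibres_le[where f = "\<lambda>c. lin c"])
  fix h
  have "card {c \<in> {c\<in>chamb. pnt c = P \<and> lin c \<in> L}. lin c = h} \<le> card {c\<in>chamb. pnt c = P \<and> lin c = h}"
    by (rule card_mono) (auto simp: finite_chamb)
  then show "card {c \<in> {c\<in>chamb. pnt c = P \<and> lin c \<in> L}. lin c = h} \<le> q + 1"
    using card_chamb_point_line order_trans by blast
qed (use finite_chamb assms in auto)

lemma card_chamb_point:
  assumes "P \<in> Pt"
  shows "card {c\<in>chamb. pnt c = P} \<le> (q\<^sup>2 + q + 1) * (q + 1)"
proof -
  have "{c\<in>chamb. pnt c = P} = {c\<in>chamb. pnt c = P \<and> pln c \<in> {h\<in>Pl. P \<sqsubseteq> h}}"
    using chambD by blast
  then show ?thesis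
    using card_chamb_planes[of "{h\<in>Pl. P \<sqsubseteq> h}" P] finite_Pl planes_on_point[OF assms] by simp
qed

text \<open>Stated for every \<open>h\<close> of the type, because it will be applied to an
  exceptional plane that may be a dummy value.\<close>

lemma card_chamb_plane_le:
  assumes "F \<subseteq> chamb"
  shows "card {c\<in>F. pln c = h} \<le> (q\<^sup>2 + q + 1) * (q + 1)"
proof (cases "h \<in> Pl")
  case True
  interpret D: pg3 Pl Ln Pt "\<lambda>x y. y \<sqsubseteq> x" q by (rule dual)
  have "card {c\<in>F. pln c = h} \<le> card {c\<in>chamb. pln c = h}"
    by (rule card_mono) (use finite_chamb assms in auto)
  then show ?thesis using D.card_chamb_point[OF True] unfolding flip_chamb card_flip_Collect by simp
next
  case False
  then have "{c\<in>F. pln c = h} = {}" using chambD(3) assms by blast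
  then show ?thesis by (simp only: card.empty)
qed

lemma planes_on_two_points:
  assumes "P \<in> Pt" "Q \<in> Pt" "P \<noteq> Q"
  shows "{h\<in>Pl. P \<sqsubseteq> h \<and> Q \<sqsubseteq> h} = {h\<in>Pl. join P Q \<sqsubseteq> h}"
  using join[OF assms] line_in_plane[OF assms] le_trans by blast

text \<open>In the quotient plane at \<open>P\<close>, the chamber \<open>d\<close> projects to a flag, and only few flags are not
  opposite to a given one.\<close>

lemma heavy_point:
  assumes F: "crossing F" and P: "P \<in> Pt"
    and heavy: "card {c\<in>F. pnt c = P} > 2 * (q + 1)\<^sup>2" and d: "d \<in> F"
  shows "P \<sqsubseteq> pln d"
proof (rule ccontr)
  assume n: "\<not> P \<sqsubseteq> pln d"
  note d' = chambD[OF crossingD(1)[OF F d]]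
  have PQ: "P \<noteq> pnt d" and nl: "\<not> P \<sqsubseteq> lin d" using n d' le_trans by auto
  obtain h0 where h0: "h0 \<in> Pl" "P \<sqsubseteq> h0" "lin d \<sqsubseteq> h0" using plane_ex[OF P d'(2)] by blast
  \<comment> \<open>A chamber at \<open>P\<close> not opposite to \<open>d\<close> has its plane in
    \<open>?H\<close>, the planes through the line joining \<open>P\<close> and
    \<open>pnt d\<close>, or its line in \<open>?L\<close>, the lines through \<open>P\<close> in
    the span \<open>h0\<close> of \<open>P\<close> and \<open>lin d\<close>. Both sets have
    \<open>q + 1\<close> members, each carrying at most \<open>q + 1\<close> chambers at
    \<open>P\<close>.\<close>
  let ?H = "{h\<in>Pl. P \<sqsubseteq> h \<and> pnt d \<sqsubseteq> h}" and ?L = "{l\<in>Ln. P \<sqsubseteq> l \<and> l \<sqsubseteq> h0}"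
  let ?A = "{c\<in>chamb. pnt c = P \<and> pln c \<in> ?H}" and ?B = "{c\<in>chamb. pnt c = P \<and> lin c \<in> ?L}"
  have "{c\<in>F. pnt c = P} \<subseteq> ?A \<union> ?B"
  proof
    fix c assume c: "c \<in> {c\<in>F. pnt c = P}"
    then have c': "c \<in> chamb" "pnt c = P" using crossingD(1)[OF F] by auto
    note cc = chambD[OF c'(1)]
    have "pnt d \<sqsubseteq> pln c \<or> meets (lin c) (lin d)" using crossingD(2)[OF F, of c d] c d n by auto
    then show "c \<in> ?A \<union> ?B"
    proof
      assume "pnt d \<sqsubseteq> pln c" then show ?thesis using c' cc by auto
    next
      assume "meets (lin c) (lin d)"
      then obtain X where X: "X \<in> Pt" "X \<sqsubseteq> lin c" "X \<sqsubseteq> lin d" unfolding meets_def by blast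
      then have "X \<noteq> P" "X \<sqsubseteq> h0" using nl h0 le_trans by auto
      then have "lin c \<sqsubseteq> h0" using line_in_plane[of P X "lin c" h0] P X h0 cc c' by auto
      then show ?thesis using c' cc by auto
    qed
  qed
  then have "card {c\<in>F. pnt c = P} \<le> card (?A \<union> ?B)"
    by (rule card_mono[rotated]) (simp add: finite_chamb)
  also have "\<dots> \<le> card ?A + card ?B" by (rule card_Un_le)
  also have "\<dots> \<le> card ?H * (q + 1) + card ?L * (q + 1)"
    by (intro add_mono card_chamb_planes card_chamb_lines) (simp_all add: finite_Pl finite_Ln)
  also have "\<dots> = 2 * (q + 1)\<^sup>2"
    using planes_on_two_points[OF P d'(1) PQ] planes_on_line[OF join(1)[OF P d'(1) PQ]]
      lines_on_flag[OF P h0(1,2)] by (simp add: power2_eq_square)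
  finally show False using heavy by simp
qed

lemma heavy_plane:
  assumes F: "crossing F" and h: "h \<in> Pl"
    and heavy: "card {c\<in>F. pln c = h} > 2 * (q + 1)\<^sup>2" and d: "d \<in> F"
  shows "pnt d \<sqsubseteq> h"
proof -
  interpret D: pg3 Pl Ln Pt "\<lambda>x y. y \<sqsubseteq> x" q by (rule dual)
  show ?thesis
    using D.heavy_point[OF crossing_dual[OF F] h, of "flip d"] heavy d
    by (simp add: card_flip_Collect)
qed

text \<open>Two skew lines \<open>l\<close>, \<open>lin d\<close> identify the points of one with the planes on the other, so that the
  chambers on \<open>l\<close> not opposite to \<open>d\<close> form a cross in a grid.\<close>

lemma fat_line:
  assumes F: "crossing F" and l: "l \<in> Ln"
    and fat: "card {c\<in>F. lin c = l} > 2 * (q + 1)" and d: "d \<in> F"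
  shows "meets l (lin d)"
proof (rule ccontr)
  assume n: "\<not> meets l (lin d)"
  note d' = chambD[OF crossingD(1)[OF F d]]
  \<comment> \<open>\<open>X\<close> is the only point of \<open>l\<close> on \<open>pln d\<close>,
    and \<open>h\<close> the only plane through \<open>l\<close> and \<open>pnt d\<close>. A chamber
    on \<open>l\<close> not opposite to \<open>d\<close> has point \<open>X\<close> or plane
    \<open>h\<close>.\<close>
  obtain X where X: "X \<in> Pt" "X \<sqsubseteq> pln d" "X \<sqsubseteq> l" using point_ex[OF d'(3) l] by blast
  obtain h where h: "h \<in> Pl" "pnt d \<sqsubseteq> h" "l \<sqsubseteq> h" using plane_ex[OF d'(1) l] by blast
  have npl: "\<not> l \<sqsubseteq> pln d" using n meets_iff_coplanar[OF l d'(2)] d' by blast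
  have npt: "\<not> pnt d \<sqsubseteq> l" using n d' meets_def by blast
  let ?A = "{c\<in>chamb. pnt c = X \<and> lin c = l}" and ?B = "{c\<in>chamb. lin c = l \<and> pln c = h}"
  have "{c\<in>F. lin c = l} \<subseteq> ?A \<union> ?B"
  proof
    fix c assume c: "c \<in> {c\<in>F. lin c = l}"
    then have c': "c \<in> chamb" "lin c = l" using crossingD(1)[OF F] by auto
    note cc = chambD[OF c'(1)]
    have "pnt c \<sqsubseteq> pln d \<or> pnt d \<sqsubseteq> pln c" using crossingD(2)[OF F, of c d] c d n by auto
    then show "c \<in> ?A \<union> ?B"
    proof
      assume "pnt c \<sqsubseteq> pln d"
      then have "pnt c = X" using line_in_plane[of "pnt c" X l "pln d"] X l d' cc c' npl by auto
      then show ?thesis using c' by auto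
    next
      assume "pnt d \<sqsubseteq> pln c"
      then have "pln c = h" using plane_unique[OF d'(1) l npt cc(3) h(1)] cc c' h by auto
      then show ?thesis using c' by auto
    qed
  qed
  then have "card {c\<in>F. lin c = l} \<le> card (?A \<union> ?B)"
    by (rule card_mono[rotated]) (simp add: finite_chamb)
  also have "\<dots> \<le> card ?A + card ?B" by (rule card_Un_le)
  also have "\<dots> \<le> 2 * (q + 1)"
    using card_chamb_point_line[of X l] card_chamb_line_plane[of l h] by simp
  finally show False using fat by simp
qed

text \<open>All planes of \<open>F\<close> contain the line \<open>g\<close> through the two heavy
  points, so at most \<open>q + 1\<close> planes occur. If two planes are heavy as well, all points
  of \<open>F\<close> lie on their common line, which leaves \<open>(q + 1)^2\<close> point-plane
  pairs. Otherwise all planes but one carry at most \<open>2 * (q + 1)^2\<close> chambers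
  each.\<close>

lemma two_heavy_points:
  assumes F: "crossing F" and P: "P \<in> Pt" "Q \<in> Pt" "P \<noteq> Q"
    and heavy: "card {c\<in>F. pnt c = P} > 2 * (q + 1)\<^sup>2" "card {c\<in>F. pnt c = Q} > 2 * (q + 1)\<^sup>2"
  shows "card F \<le> 3 * (q + 1)^3"
proof -
  define g where "g = join P Q"
  have g: "g \<in> Ln" unfolding g_def by (rule join(1)[OF P])
  let ?G = "{h\<in>Pl. g \<sqsubseteq> h}"
  have G: "finite ?G" "card ?G = q + 1" using finite_Pl planes_on_line[OF g] by auto
  have pl: "pln d \<in> ?G" if "d \<in> F" for d
    using heavy_point[OF F P(1) heavy(1) that] heavy_point[OF F P(2) heavy(2) that]
      planes_on_two_points[OF P] chambD(3)[OF crossingD(1)[OF F that]] unfolding g_def by blast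
  note finF = crossing_finite[OF F]
  show ?thesis
  proof (cases "\<exists>h\<in>Pl. \<exists>h'\<in>Pl. h \<noteq> h' \<and> card {c\<in>F. pln c = h} > 2 * (q + 1)\<^sup>2 \<and>
      card {c\<in>F. pln c = h'} > 2 * (q + 1)\<^sup>2")
    case True
    then obtain h h' where h: "h \<in> Pl" "h' \<in> Pl" "h \<noteq> h'"
      "card {c\<in>F. pln c = h} > 2 * (q + 1)\<^sup>2" "card {c\<in>F. pln c = h'} > 2 * (q + 1)\<^sup>2" by blast
    obtain m where m: "m \<in> Ln" "m \<sqsubseteq> h" "m \<sqsubseteq> h'" using planes_line[OF h(1-3)] by blast
    let ?M = "{X\<in>Pt. X \<sqsubseteq> m}"
    have "pnt d \<in> ?M" if "d \<in> F" for d
      using heavy_plane[OF F h(1) h(4) that] heavy_plane[OF F h(2) h(5) that]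
        point_on_line[OF _ m(1) h(1-3) m(2,3)] chambD(1)[OF crossingD(1)[OF F that]] by blast
    then have "card F \<le> card (?M \<times> ?G) * (q + 1)"
    proof (intro card_fibres_le[where f = "\<lambda>c. (pnt c, pln c)"])
      fix y
      have "card {c\<in>F. (pnt c, pln c) = y} \<le> card {c\<in>chamb. pnt c = fst y \<and> pln c = snd y}"
        by (rule card_mono) (use finite_chamb crossingD(1)[OF F] in auto)
      then show "card {c\<in>F. (pnt c, pln c) = y} \<le> q + 1"
        using card_chamb_point_plane order_trans by blast
    qed (use finF finite_Pt finite_Pl pl in auto)
    also have "\<dots> = (q + 1)^3"
      using points_on_line[OF m(1)] G by (simp add: card_cartesian_product power3_eq_cube)
    finally show ?thesis by simp
  next
    case False
    \<comment> \<open>At most one plane is heavy; \<open>h\<close> is that plane if it exists and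
      arbitrary otherwise.\<close>
    then obtain h where h: "\<And>h'. h' \<in> Pl \<Longrightarrow> h' \<noteq> h \<Longrightarrow> card {c\<in>F. pln c = h'} \<le> 2 * (q + 1)\<^sup>2"
      by (meson not_le)
    have "card {c\<in>F. pln c = h} \<le> (q\<^sup>2 + q + 1) * (q + 1)"
      by (rule card_chamb_plane_le) (use F in \<open>simp add: crossing_def\<close>)
    moreover have "card {c\<in>F. pln c \<noteq> h} \<le> card ?G * (2 * (q + 1)\<^sup>2)"
    proof (rule card_fibres_le[where f = "\<lambda>c. pln c"])
      fix h' assume h': "h' \<in> ?G"
      show "card {c \<in> {c\<in>F. pln c \<noteq> h}. pln c = h'} \<le> 2 * (q + 1)\<^sup>2"
      proof (cases "h' = h")
        case True
        then have "{c \<in> {c\<in>F. pln c \<noteq> h}. pln c = h'} = {}" by auto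
        then show ?thesis by (simp only: card.empty)
      next
        case False
        then have "{c \<in> {c\<in>F. pln c \<noteq> h}. pln c = h'} = {c\<in>F. pln c = h'}" by auto
        then show ?thesis using h[of h'] h' False by simp
      qed
    qed (use finF finite_Pl pl in auto)
    moreover have "card F = card {c\<in>F. pln c = h} + card {c\<in>F. pln c \<noteq> h}"
      by (subst card_Un_disjoint[symmetric]) (use finF in \<open>auto intro: arg_cong[where f = card]\<close>)
    ultimately have "card F \<le> (q\<^sup>2 + q + 1) * (q + 1) + (q + 1) * (2 * (q + 1)\<^sup>2)" using G by simp
    also have "\<dots> \<le> 3 * (q + 1)^3" by (simp add: power2_eq_square power3_eq_cube algebra_simps)
    finally show ?thesis .
  qed
qed

lemma two_heavy_planes:
  assumes F: "crossing F" and P: "h \<in> Pl" "h' \<in> Pl" "h \<noteq> h'"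
    and heavy: "card {c\<in>F. pln c = h} > 2 * (q + 1)\<^sup>2" "card {c\<in>F. pln c = h'} > 2 * (q + 1)\<^sup>2"
  shows "card F \<le> 3 * (q + 1)^3"
proof -
  interpret D: pg3 Pl Ln Pt "\<lambda>x y. y \<sqsubseteq> x" q by (rule dual)
  show ?thesis
    using D.two_heavy_points[OF crossing_dual[OF F] P] heavy by (simp add: card_flip_Collect)
qed

end

section \<open>Counting pairs of chambers\<close>

text \<open>Second moment of the degrees: both sides count triples of \<open>x\<close>,
  \<open>x'\<close> and \<open>y\<close> with \<open>x\<close> and \<open>x'\<close> both related to
  \<open>y\<close>.\<close>

lemma sum_card_square:
  assumes "finite A" "finite B"
  shows "(\<Sum>y\<in>B. (card {x\<in>A. R x y})\<^sup>2) = (\<Sum>x\<in>A. \<Sum>x'\<in>A. card {y\<in>B. R x y \<and> R x' y})"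
proof -
  have "(\<Sum>x\<in>A. \<Sum>x'\<in>A. card {y\<in>B. R x y \<and> R x' y}) =
      (\<Sum>z\<in>A\<times>A. card {y\<in>B. R (fst z) y \<and> R (snd z) y})"
    by (simp add: sum.cartesian_product split_beta)
  also have "\<dots> = (\<Sum>y\<in>B. card {z\<in>A\<times>A. R (fst z) y \<and> R (snd z) y})"
    by (rule sum_card_swap) (use assms in auto)
  also have "{z\<in>A\<times>A. R (fst z) y \<and> R (snd z) y} = {x\<in>A. R x y} \<times> {x\<in>A. R x y}" for y by auto
  then have "(\<Sum>y\<in>B. card {z\<in>A\<times>A. R (fst z) y \<and> R (snd z) y}) = (\<Sum>y\<in>B. (card {x\<in>A. R x y})\<^sup>2)"
    by (simp add: card_cartesian_product power2_eq_square)
  finally show ?thesis by simp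
qed

text \<open>Both the sum of squares and the sum over \<open>x\<close> of the size of its own fibre
  count pairs with equal image.\<close>

lemma sum_card_fibres_square:
  assumes "finite A" "finite B" "f ` A \<subseteq> B" "\<And>y. y \<in> B \<Longrightarrow> card {x\<in>A. f x = y} \<le> k"
  shows "(\<Sum>y\<in>B. (card {x\<in>A. f x = y})\<^sup>2) \<le> card A * k"
proof -
  have "(\<Sum>y\<in>B. (card {x\<in>A. f x = y})\<^sup>2) = (\<Sum>x\<in>A. card {z\<in>A. f z = f x})"
    using sum_fun_comp[OF assms(1,2,3), of "\<lambda>y. card {z\<in>A. f z = y}"]
    by (simp add: power2_eq_square)
  also have "\<dots> \<le> card A * k"
    using sum_bounded_above[of A "\<lambda>x. card {z\<in>A. f z = f x}" k] assms(3,4) by auto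
  finally show ?thesis .
qed

text \<open>Replaces the Cauchy-Schwarz inequality in the mixing arguments; a suitable weight
  \<open>k\<close> avoids square roots.\<close>

lemma weighted_am_gm:
  fixes x y k :: real
  assumes "k > 0"
  shows "2 * (x * y) \<le> k * x\<^sup>2 + y\<^sup>2 / k"
proof -
  have "0 \<le> (k * x - y)\<^sup>2 / k" using assms by simp
  also have "\<dots> = k * x\<^sup>2 + y\<^sup>2 / k - 2 * (x * y)"
    using assms by (simp add: power2_eq_square field_simps)
  finally show ?thesis by simp
qed

section \<open>Meeting lines, pair counts and the bound for independent sets outside all
  stars\<close>

context pg3 begin

text \<open>Avoiding \<open>X\<close>, the line \<open>l\<close> meets \<open>l1\<close> and
  \<open>l2\<close> in two different points, and both lie in \<open>h\<close>.\<close>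

lemma line_in_plane_of_pencil:
  assumes "l1 \<in> Ln" "l2 \<in> Ln" "l1 \<noteq> l2" "h \<in> Pl" "l1 \<sqsubseteq> h" "l2 \<sqsubseteq> h"
    and "X \<in> Pt" "X \<sqsubseteq> l1" "X \<sqsubseteq> l2" "l \<in> Ln" "meets l l1" "meets l l2" "\<not> X \<sqsubseteq> l"
  shows "l \<sqsubseteq> h"
proof -
  obtain Y where Y: "Y \<in> Pt" "Y \<sqsubseteq> l" "Y \<sqsubseteq> l1" using assms(11) meets_def by auto
  obtain Z where Z: "Z \<in> Pt" "Z \<sqsubseteq> l" "Z \<sqsubseteq> l2" using assms(12) meets_def by auto
  have "Y \<noteq> X" using Y assms by auto
  then have "Y \<noteq> Z" using line_unique[of X Y l1 l2] Y Z assms by auto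
  moreover have "Y \<sqsubseteq> h" "Z \<sqsubseteq> h" using Y Z assms le_trans by blast+
  ultimately show ?thesis using line_in_plane[of Y Z l h] Y Z assms by blast
qed

text \<open>Two lines of \<open>M\<close> determine a point \<open>X\<close> and a plane
  \<open>h\<close>. The pencil of lines through \<open>X\<close> in \<open>h\<close> has only
  \<open>q + 1\<close> members, so some \<open>l3\<close> in \<open>M\<close> lies outside it. If
  \<open>l3\<close> passes through \<open>X\<close>, a transversal avoiding \<open>X\<close> would
  lie in both \<open>h\<close> and the span of \<open>l1\<close> and \<open>l3\<close>, hence equal
  \<open>l1\<close>. Otherwise \<open>l3\<close> lies in \<open>h\<close>, and a transversal through
  \<open>X\<close> has a second point in \<open>h\<close> on \<open>l3\<close>.\<close>

lemma transversals_of_many_lines: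
  assumes M: "M \<subseteq> Ln" "card M > q + 1" and meet: "\<And>l m. l \<in> M \<Longrightarrow> m \<in> M \<Longrightarrow> meets l m"
  shows "(\<exists>X\<in>Pt. \<forall>l\<in>Ln. (\<forall>m\<in>M. meets l m) \<longrightarrow> X \<sqsubseteq> l) \<or>
    (\<exists>h\<in>Pl. \<forall>l\<in>Ln. (\<forall>m\<in>M. meets l m) \<longrightarrow> l \<sqsubseteq> h)"
proof -
  have finM: "finite M" using M finite_Ln finite_subset by blast
  have "\<not> M \<subseteq> {l}" for l using card_mono[of "{l}" M] M(2) by auto
  then obtain l1 l2 where l: "l1 \<in> M" "l2 \<in> M" "l1 \<noteq> l2" by blast
  then have L: "l1 \<in> Ln" "l2 \<in> Ln" using M by auto
  obtain X where X: "X \<in> Pt" "X \<sqsubseteq> l1" "X \<sqsubseteq> l2" using meet[OF l(1,2)] meets_def by auto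
  obtain h where h: "h \<in> Pl" "l1 \<sqsubseteq> h" "l2 \<sqsubseteq> h"
    using coplanar_if_meets[OF L meet[OF l(1,2)]] by blast
  have Xh: "X \<sqsubseteq> h" using X h le_trans by blast
  have "\<not> M \<subseteq> {l\<in>Ln. X \<sqsubseteq> l \<and> l \<sqsubseteq> h}"
    using card_mono[of "{l\<in>Ln. X \<sqsubseteq> l \<and> l \<sqsubseteq> h}" M] lines_on_flag[OF X(1) h(1) Xh] M finite_Ln by auto
  then obtain l3 where l3: "l3 \<in> M" "l3 \<in> Ln" "\<not> (X \<sqsubseteq> l3 \<and> l3 \<sqsubseteq> h)" using M by blast
  have inh: "l \<sqsubseteq> h" if "l \<in> Ln" "\<forall>m\<in>M. meets l m" "\<not> X \<sqsubseteq> l" for l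
    using line_in_plane_of_pencil[OF L l(3) h X that(1)] that l by blast
  show ?thesis
  proof (cases "X \<sqsubseteq> l3")
    case True
    then have l3h: "\<not> l3 \<sqsubseteq> h" using l3 by simp
    obtain h' where h': "h' \<in> Pl" "l1 \<sqsubseteq> h'" "l3 \<sqsubseteq> h'"
      using coplanar_if_meets[OF L(1) l3(2) meet[OF l(1) l3(1)]] by blast
    have "h \<noteq> h'" "l1 \<noteq> l3" using l3h h' h by auto
    have "X \<sqsubseteq> l" if "l \<in> Ln" "\<forall>m\<in>M. meets l m" for l
    proof (rule ccontr)
      assume n: "\<not> X \<sqsubseteq> l"
      have "l \<sqsubseteq> h'"
        using line_in_plane_of_pencil[OF L(1) l3(2) \<open>l1 \<noteq> l3\<close> h' X(1,2) True that(1)] that n l l3 by blast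
      then have "l = l1"
        using two_planes_line_unique[OF h(1) h'(1) \<open>h \<noteq> h'\<close> that(1) L(1)] inh[OF that n] h h' by blast
      then show False using n X by simp
    qed
    then show ?thesis using X by blast
  next
    case False
    then have l3h: "l3 \<sqsubseteq> h" using inh[OF l3(2)] meet l3(1) by blast
    have "l \<sqsubseteq> h" if "l \<in> Ln" "\<forall>m\<in>M. meets l m" for l
    proof (cases "X \<sqsubseteq> l")
      case True
      have "meets l l3" using that l3(1) by blast
      then obtain Y where Y: "Y \<in> Pt" "Y \<sqsubseteq> l" "Y \<sqsubseteq> l3" unfolding meets_def by blast
      have "Y \<noteq> X" "Y \<sqsubseteq> h" using False Y le_trans[OF Y(3) l3h] by auto
      then show ?thesis using line_in_plane[of X Y l h] X(1) Y True Xh that(1) h(1) by blast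
    qed (use inh that in blast)
    then show ?thesis using h by blast
  qed
qed

text \<open>An entry of the Gram matrix \<open>(q + 1) J + q^2 I\<close> of point-plane incidence,
  split into constant and diagonal part for use in second moments.\<close>

lemma planes_on_two_points_card:
  assumes "P \<in> Pt" "Q \<in> Pt"
  shows "card {h\<in>Pl. P \<sqsubseteq> h \<and> Q \<sqsubseteq> h} = q + 1 + (if P = Q then q\<^sup>2 else 0)"
proof (cases "P = Q")
  case False
  then show ?thesis
    using planes_on_two_points[OF assms False] planes_on_line[OF join(1)[OF assms False]] by simp
qed (use planes_on_point[OF assms(1)] in simp)

text \<open>Likewise the Gram matrix \<open>J + (q^2 + q) I\<close> of point-line incidence.\<close>

lemma lines_on_two_points_card:
  assumes "P \<in> Pt" "Q \<in> Pt"
  shows "card {l\<in>Ln. P \<sqsubseteq> l \<and> Q \<sqsubseteq> l} = 1 + (if P = Q then q\<^sup>2 + q else 0)"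
proof (cases "P = Q")
  case False
  then have "{l\<in>Ln. P \<sqsubseteq> l \<and> Q \<sqsubseteq> l} = {join P Q}"
    using join[OF assms] join_eq[OF assms] by blast
  then show ?thesis using False by simp
qed (use lines_on_point[OF assms(1)] in simp)

text \<open>Expander mixing for the point-plane incidence graph, as a variance computation around the
  value \<open>m / q\<close>.\<close>

lemma point_plane_pairs:
  assumes F: "F \<subseteq> chamb"
    and pt: "\<And>P. P \<in> Pt \<Longrightarrow> card {c\<in>F. pnt c = P} \<le> k"
    and pl: "\<And>h. h \<in> Pl \<Longrightarrow> card {c\<in>F. pln c = h} \<le> k"
  shows "real (\<Sum>d\<in>F. card {c\<in>F. pnt c \<sqsubseteq> pln d}) \<le> (real (card F))\<^sup>2 / q + q * k * card F"
proof -
  have finF: "finite F" using F finite_chamb finite_subset by blast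
  define m where "m = real (card F)"
  define A where "A h = card {c\<in>F. pnt c \<sqsubseteq> h}" for h
  define b where "b h = card {c\<in>F. pln c = h}" for h
  have q0: "real q > 0" using q2 by simp
  have "(\<Sum>h\<in>Pl. A h) = (\<Sum>c\<in>F. card {h\<in>Pl. pnt c \<sqsubseteq> h})"
    unfolding A_def by (rule sum_card_swap[OF finite_Pl finF])
  also have "\<dots> = card F * (q\<^sup>2 + q + 1)"
    by (simp add: planes_on_point chambD(1) subsetD[OF F])
  finally have S1: "(\<Sum>h\<in>Pl. real (A h)) = m * (q\<^sup>2 + q + 1)"
    unfolding m_def by (metis of_nat_mult of_nat_sum)
  have "(\<Sum>h\<in>Pl. (A h)\<^sup>2) = (\<Sum>c\<in>F. \<Sum>d\<in>F. card {h\<in>Pl. pnt c \<sqsubseteq> h \<and> pnt d \<sqsubseteq> h})"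
    unfolding A_def by (rule sum_card_square[OF finF finite_Pl])
  also have "\<dots> = (\<Sum>c\<in>F. \<Sum>d\<in>F. q + 1 + (if pnt c = pnt d then q\<^sup>2 else 0))"
    by (intro sum.cong refl planes_on_two_points_card chambD(1) subsetD[OF F])
  also have "\<dots> = (\<Sum>c\<in>F. card F * (q + 1) + card {d\<in>F. pnt c = pnt d} * q\<^sup>2)"
    using finF by (simp add: sum.distrib sum_Suc sum.If_cases Int_def algebra_simps)
  also have "\<dots> \<le> (\<Sum>c\<in>F. card F * (q + 1) + k * q\<^sup>2)"
  proof (intro sum_mono add_mono mult_right_mono)
    fix c assume "c \<in> F"
    then show "card {d\<in>F. pnt c = pnt d} \<le> k"
      using pt[of "pnt c"] chambD(1)[of c] F by (auto simp: eq_commute)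
  qed auto
  also have "\<dots> = card F * (card F * (q + 1) + k * q\<^sup>2)" by simp
  finally have "real (\<Sum>h\<in>Pl. (A h)\<^sup>2) \<le> real (card F * (card F * (q + 1) + k * q\<^sup>2))"
    by (rule of_nat_mono)
  then have S2: "(\<Sum>h\<in>Pl. (real (A h))\<^sup>2) \<le> m * (m * (q + 1) + k * q\<^sup>2)"
    unfolding m_def by (simp add: algebra_simps)
  have "(\<Sum>h\<in>Pl. (real (A h) - m / q)\<^sup>2) =
      (\<Sum>h\<in>Pl. (real (A h))\<^sup>2) - 2 * (m / q) * (\<Sum>h\<in>Pl. real (A h)) + card Pl * (m / q)\<^sup>2"
    by (simp add: power2_diff sum.distrib sum_subtractf sum_distrib_left sum_divide_distrib algebra_simps)
  also have "\<dots> \<le> m * (m * (q + 1) + k * q\<^sup>2) - 2 * (m / q) * (m * (q\<^sup>2 + q + 1))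
      + (q^3 + q\<^sup>2 + q + 1) * (m / q)\<^sup>2"
    using S2 unfolding S1 card_Pl by simp
  also have "\<dots> = k * q\<^sup>2 * m + m\<^sup>2 * (1 / q\<^sup>2 - 1 / q)"
    using q0 by (simp add: field_simps power2_eq_square power3_eq_cube)
  also have "\<dots> \<le> k * q\<^sup>2 * m"
  proof -
    have "1 / real q ^ 2 \<le> 1 / q" using q2 by (simp add: field_simps power2_eq_square)
    then show ?thesis by (simp add: mult_nonneg_nonpos)
  qed
  finally have V: "(\<Sum>h\<in>Pl. (real (A h) - m / q)\<^sup>2) \<le> k * q\<^sup>2 * m" .
  have "(\<Sum>h\<in>Pl. (b h)\<^sup>2) \<le> card F * k"
    unfolding b_def by (rule sum_card_fibres_square[OF finF finite_Pl]) (use F chambD(3) pl in auto)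
  then have "real (\<Sum>h\<in>Pl. (b h)\<^sup>2) \<le> real (card F * k)" by (rule of_nat_mono)
  then have B2: "(\<Sum>h\<in>Pl. (real (b h))\<^sup>2) \<le> m * k" unfolding m_def by simp
  have im: "pln ` F \<subseteq> Pl" using F chambD(3) by auto
  have "2 * (real (\<Sum>d\<in>F. A (pln d)) - m * (m / q)) = 2 * (\<Sum>d\<in>F. real (A (pln d)) - m / q)"
    by (simp add: sum_subtractf m_def)
  also have "\<dots> = (\<Sum>h\<in>Pl. 2 * (real (b h) * (real (A h) - m / q)))"
    unfolding b_def using sum_fun_comp[OF finF finite_Pl im, of "\<lambda>h. real (A h) - m / q"]
    by (simp add: sum_distrib_left)
  \<comment> \<open>The weight \<open>q\<close> balances the two bounds: each part contributes at
    most \<open>q * k * m\<close>.\<close>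
  also have "\<dots> \<le> (\<Sum>h\<in>Pl. q * (real (b h))\<^sup>2 + (real (A h) - m / q)\<^sup>2 / q)"
    by (intro sum_mono weighted_am_gm q0)
  also have "\<dots> = q * (\<Sum>h\<in>Pl. (real (b h))\<^sup>2) + (\<Sum>h\<in>Pl. (real (A h) - m / q)\<^sup>2) / q"
    by (simp add: sum.distrib sum_distrib_left sum_divide_distrib)
  also have "\<dots> \<le> q * (m * k) + (k * q\<^sup>2 * m) / q"
    using B2 V q0 by (intro add_mono mult_left_mono divide_right_mono) auto
  also have "\<dots> = 2 * (q * k * m)" using q0 by (simp add: field_simps power2_eq_square)
  finally show ?thesis unfolding A_def m_def by (simp add: power2_eq_square)
qed

text \<open>\<open>W x\<close> counts the chambers whose line passes through \<open>x\<close>; its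
  mean is \<open>m / (q^2 + 1)\<close>, and its second moment bounds the number of meeting pairs.
  Since the deviations \<open>f\<close> sum to zero, the Gram matrix \<open>J + K I\<close> makes
  the sum of squares of \<open>g\<close> equal to \<open>S * K\<close>. Pairing \<open>g\<close>
  with the multiplicities \<open>v\<close> then bounds \<open>S\<close> by
  \<open>K * k * m\<close>.\<close>

lemma line_pairs:
  assumes F: "F \<subseteq> chamb" and w: "\<And>l. l \<in> Ln \<Longrightarrow> card {c\<in>F. lin c = l} \<le> k"
  shows "real (\<Sum>c\<in>F. card {d\<in>F. meets (lin c) (lin d)}) \<le>
    (real (card F))\<^sup>2 * (q + 1) / (q\<^sup>2 + 1) + (q\<^sup>2 + q) * k * card F"
proof -
  have finF: "finite F" using F finite_chamb finite_subset by blast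
  define m where "m = real (card F)"
  define W where "W x = card {c\<in>F. x \<sqsubseteq> lin c}" for x
  define v where "v l = card {c\<in>F. lin c = l}" for l
  define f where "f x = real (W x) - m / (q\<^sup>2 + 1)" for x
  define g where "g l = (\<Sum>x\<in>{x\<in>Pt. x \<sqsubseteq> l}. f x)" for l
  define K where "K = real (q\<^sup>2 + q)"
  define S where "S = (\<Sum>x\<in>Pt. (f x)\<^sup>2)"
  have K0: "K > 0" using q2 unfolding K_def by (simp only: of_nat_0_less_iff)
  have cPt: "real (card Pt) = (q\<^sup>2 + 1) * (q + 1)"
    unfolding card_Pt by (simp add: power2_eq_square power3_eq_cube algebra_simps)
  have "(\<Sum>x\<in>Pt. W x) = (\<Sum>c\<in>F. card {x\<in>Pt. x \<sqsubseteq> lin c})"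
    unfolding W_def by (rule sum_card_swap[OF finite_Pt finF])
  also have "\<dots> = card F * (q + 1)"
    by (simp add: points_on_line chambD(2) subsetD[OF F])
  finally have "(\<Sum>x\<in>Pt. real (W x)) = m * (q + 1)"
    unfolding m_def by (metis of_nat_mult of_nat_sum)
  moreover have "real (q\<^sup>2 + 1) \<noteq> 0" by (simp only: of_nat_eq_0_iff)
  ultimately have f0: "(\<Sum>x\<in>Pt. f x) = 0"
    unfolding f_def by (simp only: sum_subtractf sum_constant cPt) (simp add: field_simps)
  have "(\<Sum>l\<in>Ln. (g l)\<^sup>2) = (\<Sum>l\<in>Ln. \<Sum>x\<in>Pt. \<Sum>y\<in>Pt. if x \<sqsubseteq> l \<and> y \<sqsubseteq> l then f x * f y else 0)"
  proof (rule sum.cong[OF refl])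
    fix l
    have "g l = (\<Sum>x\<in>Pt. if x \<sqsubseteq> l then f x else 0)"
      unfolding g_def by (simp add: sum.inter_filter finite_Pt)
    then have "(g l)\<^sup>2 = (\<Sum>x\<in>Pt. \<Sum>y\<in>Pt. (if x \<sqsubseteq> l then f x else 0) * (if y \<sqsubseteq> l then f y else 0))"
      by (simp add: power2_eq_square sum_product)
    also have "\<dots> = (\<Sum>x\<in>Pt. \<Sum>y\<in>Pt. if x \<sqsubseteq> l \<and> y \<sqsubseteq> l then f x * f y else 0)"
      by (intro sum.cong refl) auto
    finally show "(g l)\<^sup>2 = (\<Sum>x\<in>Pt. \<Sum>y\<in>Pt. if x \<sqsubseteq> l \<and> y \<sqsubseteq> l then f x * f y else 0)" .
  qed
  also have "\<dots> = (\<Sum>x\<in>Pt. \<Sum>l\<in>Ln. \<Sum>y\<in>Pt. if x \<sqsubseteq> l \<and> y \<sqsubseteq> l then f x * f y else 0)"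
    by (rule sum.swap)
  also have "\<dots> = (\<Sum>x\<in>Pt. \<Sum>y\<in>Pt. \<Sum>l\<in>Ln. if x \<sqsubseteq> l \<and> y \<sqsubseteq> l then f x * f y else 0)"
    by (intro sum.cong refl sum.swap)
  also have "\<dots> = (\<Sum>x\<in>Pt. \<Sum>y\<in>Pt. f x * f y * card {l\<in>Ln. x \<sqsubseteq> l \<and> y \<sqsubseteq> l})"
    using finite_Ln by (simp add: sum.If_cases Int_def mult.commute)
  also have "\<dots> = (\<Sum>x\<in>Pt. \<Sum>y\<in>Pt. f x * f y + (if x = y then f x * f y * K else 0))"
    by (intro sum.cong refl) (simp add: lines_on_two_points_card K_def algebra_simps)
  also have "\<dots> = (\<Sum>x\<in>Pt. f x) * (\<Sum>y\<in>Pt. f y) + S * K"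
    using finite_Pt by (simp add: sum.distrib sum.delta sum_product S_def sum_distrib_right[where r = K] power2_eq_square)
  finally have G: "(\<Sum>l\<in>Ln. (g l)\<^sup>2) = S * K" using f0 by simp
  have "(\<Sum>l\<in>Ln. (v l)\<^sup>2) \<le> card F * k"
    unfolding v_def by (rule sum_card_fibres_square[OF finF finite_Ln]) (use F chambD(2) w in auto)
  then have "real (\<Sum>l\<in>Ln. (v l)\<^sup>2) \<le> real (card F * k)" by (rule of_nat_mono)
  then have V: "(\<Sum>l\<in>Ln. (real (v l))\<^sup>2) \<le> m * k" unfolding m_def by simp
  have im: "(\<lambda>c. lin c) ` F \<subseteq> Ln" using F chambD(2) by auto
  have "S = (\<Sum>x\<in>Pt. f x * W x) - m / (q\<^sup>2 + 1) * (\<Sum>x\<in>Pt. f x)"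
    unfolding S_def sum_distrib_left sum_subtractf[symmetric]
    by (intro sum.cong refl) (simp add: f_def power2_eq_square algebra_simps)
  also have "\<dots> = (\<Sum>x\<in>Pt. \<Sum>c\<in>F. if x \<sqsubseteq> lin c then f x else 0)"
    using finF f0 by (simp add: sum.If_cases Int_def W_def mult.commute)
  also have "\<dots> = (\<Sum>c\<in>F. \<Sum>x\<in>Pt. if x \<sqsubseteq> lin c then f x else 0)" by (rule sum.swap)
  also have "\<dots> = (\<Sum>c\<in>F. g (lin c))"
    unfolding g_def by (simp add: sum.inter_filter finite_Pt)
  also have "\<dots> = (\<Sum>l\<in>Ln. real (v l) * g l)"
    unfolding v_def using sum_fun_comp[OF finF finite_Ln im, of g] by simp
  finally have "2 * S = (\<Sum>l\<in>Ln. 2 * (real (v l) * g l))" by (simp add: sum_distrib_left)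
  \<comment> \<open>With weight \<open>K\<close> the part in \<open>g\<close> becomes exactly
    \<open>S\<close>, which can be subtracted from \<open>2 * S\<close>.\<close>
  also have "\<dots> \<le> (\<Sum>l\<in>Ln. K * (real (v l))\<^sup>2 + (g l)\<^sup>2 / K)"
    by (intro sum_mono weighted_am_gm K0)
  also have "\<dots> = K * (\<Sum>l\<in>Ln. (real (v l))\<^sup>2) + (\<Sum>l\<in>Ln. (g l)\<^sup>2) / K"
    by (simp add: sum.distrib sum_distrib_left sum_divide_distrib)
  also have "\<dots> \<le> K * (m * k) + S"
    using V K0 unfolding G by (intro add_mono mult_left_mono) auto
  finally have S: "S \<le> K * k * m" by (simp add: algebra_simps)
  have "(\<Sum>c\<in>F. card {d\<in>F. meets (lin c) (lin d)}) =
      (\<Sum>c\<in>F. \<Sum>d\<in>F. if meets (lin c) (lin d) then 1 else 0)"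
    using finF by (simp add: sum.If_cases Int_def)
  \<comment> \<open>A meeting pair shares at least one point; equal lines are counted
    \<open>q + 1\<close> times, which only weakens the bound.\<close>
  also have "\<dots> \<le> (\<Sum>c\<in>F. \<Sum>d\<in>F. card {x\<in>Pt. x \<sqsubseteq> lin c \<and> x \<sqsubseteq> lin d})"
  proof (intro sum_mono)
    fix c d
    show "(if meets (lin c) (lin d) then 1 else 0) \<le> card {x\<in>Pt. x \<sqsubseteq> lin c \<and> x \<sqsubseteq> lin d}"
      using finite_Pt by (auto simp: meets_def Suc_le_eq card_gt_0_iff)
  qed
  also have "\<dots> = (\<Sum>x\<in>Pt. (W x)\<^sup>2)"
    unfolding W_def by (rule sum_card_square[OF finF finite_Pt, symmetric])
  finally have "real (\<Sum>c\<in>F. card {d\<in>F. meets (lin c) (lin d)}) \<le> real (\<Sum>x\<in>Pt. (W x)\<^sup>2)"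
    by (rule of_nat_mono)
  also have "\<dots> = (\<Sum>x\<in>Pt. (f x + m / (q\<^sup>2 + 1))\<^sup>2)" by (simp add: f_def)
  also have "\<dots> = S + 2 * (m / (q\<^sup>2 + 1)) * (\<Sum>x\<in>Pt. f x) + card Pt * (m / (q\<^sup>2 + 1))\<^sup>2"
    unfolding S_def
    by (simp add: power2_sum sum.distrib sum_distrib_left sum_distrib_right sum_divide_distrib algebra_simps)
  also have "\<dots> = S + m\<^sup>2 * (q + 1) / (q\<^sup>2 + 1)"
  proof -
    have "(a * b) * (m / a)\<^sup>2 = m\<^sup>2 * b / a" if "a > 0" for a b :: real
      using that by (simp add: power2_eq_square field_simps)
    from this[of "real (q\<^sup>2 + 1)" "real (q + 1)"]
    have "real (q\<^sup>2 + 1) * real (q + 1) * (m / real (q\<^sup>2 + 1))\<^sup>2 = m\<^sup>2 * real (q + 1) / real (q\<^sup>2 + 1)"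
      by (simp only: of_nat_0_less_iff)
    then show ?thesis unfolding f0 cPt of_nat_mult by (simp only: mult_zero_right add_0_right)
  qed
  finally show ?thesis using S unfolding m_def K_def by simp
qed

text \<open>Each of the \<open>m^2\<close> ordered pairs is of one of three types, and the pair
  counts give \<open>m^2 \<le> m^2 * (2 / q + (q + 1) / (q^2 + 1)) + 6 * q * (q + 1)^2 * m\<close>.
  The coefficient of \<open>m^2\<close> is at most \<open>4 / q\<close>, hence at most
  \<open>1 / 7\<close>.\<close>

lemma crossing_light_bound:
  assumes F: "crossing F" and q43: "q \<ge> 43"
    and pt: "\<And>P. P \<in> Pt \<Longrightarrow> card {c\<in>F. pnt c = P} \<le> 2 * (q + 1)\<^sup>2"
    and pl: "\<And>h. h \<in> Pl \<Longrightarrow> card {c\<in>F. pln c = h} \<le> 2 * (q + 1)\<^sup>2"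
    and li: "\<And>l. l \<in> Ln \<Longrightarrow> card {c\<in>F. lin c = l} \<le> 2 * (q + 1)"
  shows "card F \<le> 7 * q * (q + 1)\<^sup>2"
proof -
  have sub: "F \<subseteq> chamb" and finF: "finite F" using F crossing_finite by (auto simp: crossing_def)
  let ?I = "\<Sum>d\<in>F. card {c\<in>F. pnt c \<sqsubseteq> pln d}"
  let ?J = "\<Sum>c\<in>F. card {d\<in>F. meets (lin c) (lin d)}"
  define m where "m = real (card F)"
  define x where "x = real q"
  have x: "x \<ge> 43" using q43 by (simp add: x_def)
  have "(card F)\<^sup>2 = (\<Sum>c\<in>F. card F)" by (simp add: power2_eq_square)
  also have "\<dots> \<le> (\<Sum>c\<in>F. card {d\<in>F. pnt c \<sqsubseteq> pln d} + card {d\<in>F. pnt d \<sqsubseteq> pln c}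
      + card {d\<in>F. meets (lin c) (lin d)})"
  proof (rule sum_mono)
    fix c assume c: "c \<in> F"
    have "F = {d\<in>F. pnt c \<sqsubseteq> pln d} \<union> {d\<in>F. pnt d \<sqsubseteq> pln c} \<union> {d\<in>F. meets (lin c) (lin d)}"
      (is "F = ?A \<union> ?B \<union> ?C") using crossingD(2)[OF F c] by blast
    then have "card F = card (?A \<union> ?B \<union> ?C)" by (rule arg_cong)
    also have "\<dots> \<le> card (?A \<union> ?B) + card ?C" by (rule card_Un_le)
    also have "\<dots> \<le> card ?A + card ?B + card ?C" using card_Un_le[of ?A ?B] by simp
    finally show "card F \<le> card ?A + card ?B + card ?C" .
  qed
  also have "\<dots> = (\<Sum>c\<in>F. card {d\<in>F. pnt c \<sqsubseteq> pln d}) + ?I + ?J" by (simp add: sum.distrib)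
  also have "(\<Sum>c\<in>F. card {d\<in>F. pnt c \<sqsubseteq> pln d}) = ?I" by (rule sum_card_swap[OF finF finF])
  finally have "real ((card F)\<^sup>2) \<le> real (?I + ?I + ?J)" by (rule of_nat_mono)
  then have "m\<^sup>2 \<le> 2 * real ?I + real ?J" by (simp add: m_def)
  also have "\<dots> \<le> 2 * (m\<^sup>2 / x + x * (2 * (x + 1)\<^sup>2) * m)
      + (m\<^sup>2 * (x + 1) / (x\<^sup>2 + 1) + (x\<^sup>2 + x) * (2 * (x + 1)) * m)"
    using point_plane_pairs[OF sub pt pl] line_pairs[OF sub li]
    by (intro add_mono mult_left_mono) (simp_all add: m_def x_def algebra_simps)
  also have "\<dots> = m\<^sup>2 * (2 / x + (x + 1) / (x\<^sup>2 + 1)) + m * (6 * x * (x + 1)\<^sup>2)"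
    by (simp add: algebra_simps power2_eq_square)
  also have "\<dots> \<le> m\<^sup>2 * (1 / 7) + m * (6 * x * (x + 1)\<^sup>2)"
  proof -
    have "(x + 1) / (x\<^sup>2 + 1) \<le> 2 / x"
    proof -
      have "0 \<le> x * (x - 1)" using x by simp
      then have "(x + 1) * x \<le> 2 * (x\<^sup>2 + 1)" by (simp add: power2_eq_square algebra_simps)
      then show ?thesis using x by (simp add: divide_le_eq le_divide_eq add_pos_nonneg)
    qed
    moreover have "4 / x \<le> 1 / 7" using x by (simp add: field_simps)
    moreover have "2 / x + 2 / x = 4 / x" by simp
    ultimately have "2 / x + (x + 1) / (x\<^sup>2 + 1) \<le> 1 / 7" by linarith
    then show ?thesis by (intro add_right_mono mult_left_mono) auto
  qed
  finally have "m * m \<le> m * (7 * x * (x + 1)\<^sup>2)" by (simp add: power2_eq_square algebra_simps)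
  then have "m \<le> 7 * x * (x + 1)\<^sup>2"
    by (cases "m = 0") (use x in \<open>auto simp: m_def\<close>)
  then have "real (card F) \<le> real (7 * q * (q + 1)\<^sup>2)" by (simp add: m_def x_def algebra_simps)
  then show ?thesis by (simp only: of_nat_le_iff)
qed

text \<open>Unless two points or two planes are heavy, it suffices to remove the chambers at one
  point, in one plane and on the fat lines. More than \<open>q + 1\<close> fat lines would force all
  lines of \<open>F\<close> through a point or into a plane, so at most \<open>3 * (q + 1)^3\<close>
  chambers are removed. The rest is light.\<close>

lemma crossing_bound:
  assumes F: "crossing F" and q43: "q \<ge> 43"
    and not_pt: "\<not> (\<exists>X\<in>Pt. \<forall>c\<in>F. X \<sqsubseteq> lin c)" and not_pl: "\<not> (\<exists>h\<in>Pl. \<forall>c\<in>F. lin c \<sqsubseteq> h)"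
  shows "card F \<le> 11 * q * (q + 1)\<^sup>2"
proof -
  have sub: "F \<subseteq> chamb" and finF: "finite F" using F crossing_finite by (auto simp: crossing_def)
  let ?k = "2 * (q + 1)\<^sup>2"
  have small: "3 * (q + 1)^3 \<le> 11 * q * (q + 1)\<^sup>2"
  proof -
    have "3 * (q + 1)^3 = (3 * q + 3) * (q + 1)\<^sup>2" by (simp add: power2_eq_square power3_eq_cube algebra_simps)
    also have "\<dots> \<le> (11 * q) * (q + 1)\<^sup>2" using q43 by (intro mult_right_mono) auto
    finally show ?thesis .
  qed
  show ?thesis
  proof (cases "(\<exists>P\<in>Pt. \<exists>Q\<in>Pt. P \<noteq> Q \<and> card {c\<in>F. pnt c = P} > ?k \<and> card {c\<in>F. pnt c = Q} > ?k) \<or>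
      (\<exists>h\<in>Pl. \<exists>h'\<in>Pl. h \<noteq> h' \<and> card {c\<in>F. pln c = h} > ?k \<and> card {c\<in>F. pln c = h'} > ?k)")
    case True
    then have "card F \<le> 3 * (q + 1)^3"
      using two_heavy_points[OF F] two_heavy_planes[OF F] by blast
    then show ?thesis using small by simp
  next
    case False
    \<comment> \<open>\<open>P0\<close> and \<open>h0\<close> are the possible heavy point and
      plane; if there is none they are arbitrary and need not be a point or a plane.\<close>
    obtain P0 where P0: "\<And>P. P \<in> Pt \<Longrightarrow> P \<noteq> P0 \<Longrightarrow> card {c\<in>F. pnt c = P} \<le> ?k"
      using False by (meson not_le)
    obtain h0 where h0: "\<And>h. h \<in> Pl \<Longrightarrow> h \<noteq> h0 \<Longrightarrow> card {c\<in>F. pln c = h} \<le> ?k"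
      using False by (meson not_le)
    define M where "M = {l\<in>Ln. card {c\<in>F. lin c = l} > 2 * (q + 1)}"
    have meet: "meets l (lin d)" if "l \<in> M" "d \<in> F" for l d
      using fat_line[OF F] that by (simp add: M_def)
    \<comment> \<open>A fat line is the line of some chamber of \<open>F\<close>, so
      \<open>meet\<close> applies to two fat lines.\<close>
    have fibre: "\<exists>d\<in>F. lin d = m" if "m \<in> M" for m
    proof -
      have "{c\<in>F. lin c = m} \<noteq> {}" using that card.empty unfolding M_def by fastforce
      then show ?thesis by blast
    qed
    have cM: "card M \<le> q + 1"
    proof (rule ccontr)
      assume "\<not> card M \<le> q + 1"
      moreover have "meets l m" if "l \<in> M" "m \<in> M" for l m using fibre[OF that(2)] meet[OF that(1)] by blast
      moreover have "M \<subseteq> Ln" by (auto simp: M_def)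
      moreover have "\<forall>m\<in>M. meets (lin c) m" if "c \<in> F" for c
        using meet that unfolding meets_def by blast
      moreover have "lin c \<in> Ln" if "c \<in> F" for c using that sub chambD(2) by blast
      ultimately show False using transversals_of_many_lines[of M] not_pt not_pl by (metis not_le)
    qed
    define G where "G = {c\<in>F. pnt c \<noteq> P0 \<and> pln c \<noteq> h0 \<and> lin c \<notin> M}"
    have GF: "G \<subseteq> F" by (auto simp: G_def)
    have G: "card G \<le> 7 * q * (q + 1)\<^sup>2"
    proof (rule crossing_light_bound[OF crossing_subset[OF F GF] q43])
      have le: "card {c\<in>G. f c = y} \<le> card {c\<in>F. f c = y}" for f :: "'f \<times> 'f \<times> 'f \<Rightarrow> 'f" and y
        by (rule card_mono) (use finF GF in auto)
      show "card {c\<in>G. pnt c = P} \<le> ?k" if "P \<in> Pt" for P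
      proof (cases "P = P0")
        case True
        then have "{c\<in>G. pnt c = P} = {}" by (auto simp: G_def)
        then show ?thesis by (simp only: card.empty)
      qed (use P0[OF that] le[of fst P] in linarith)
      show "card {c\<in>G. pln c = h} \<le> ?k" if "h \<in> Pl" for h
      proof (cases "h = h0")
        case True
        then have "{c\<in>G. pln c = h} = {}" by (auto simp: G_def)
        then show ?thesis by (simp only: card.empty)
      qed (use h0[OF that] le[of "\<lambda>c. pln c" h] in linarith)
      show "card {c\<in>G. lin c = l} \<le> 2 * (q + 1)" if "l \<in> Ln" for l
      proof (cases "l \<in> M")
        case True
        then have "{c\<in>G. lin c = l} = {}" by (auto simp: G_def)
        then show ?thesis by (simp only: card.empty)
      next
        case False
        then have "card {c\<in>F. lin c = l} \<le> 2 * (q + 1)" using that by (auto simp: M_def)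
        then show ?thesis using le[of "\<lambda>c. lin c" l] by linarith
      qed
    qed
    have A: "card {c\<in>F. pnt c = P0} \<le> (q\<^sup>2 + q + 1) * (q + 1)"
    proof (cases "P0 \<in> Pt")
      case True
      have "card {c\<in>F. pnt c = P0} \<le> card {c\<in>chamb. pnt c = P0}"
        by (rule card_mono) (use finite_chamb sub in auto)
      then show ?thesis using card_chamb_point[OF True] by simp
    next
      case False
      then have "{c\<in>F. pnt c = P0} = {}" using sub chambD(1) by blast
      then show ?thesis by (simp only: card.empty)
    qed
    have B: "card {c\<in>F. pln c = h0} \<le> (q\<^sup>2 + q + 1) * (q + 1)"
      by (rule card_chamb_plane_le[OF sub])
    have C: "card {c\<in>F. lin c \<in> M} \<le> (q + 1) * (q + 1)\<^sup>2"
    proof -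
      have "card {c\<in>F. lin c \<in> M} \<le> card {c\<in>chamb. lin c \<in> M}"
        by (rule card_mono) (use finite_chamb sub in auto)
      also have "\<dots> = card M * (q + 1)\<^sup>2" by (rule card_chamb_line_set) (auto simp: M_def)
      also have "\<dots> \<le> (q + 1) * (q + 1)\<^sup>2" using cM by (rule mult_right_mono) simp
      finally show ?thesis .
    qed
    have "F = G \<union> ({c\<in>F. pnt c = P0} \<union> ({c\<in>F. pln c = h0} \<union> {c\<in>F. lin c \<in> M}))"
      (is "F = G \<union> (?A \<union> (?B \<union> ?C))") by (auto simp: G_def)
    then have "card F = card (G \<union> (?A \<union> (?B \<union> ?C)))" by (rule arg_cong)
    also have "\<dots> \<le> card G + (card ?A + (card ?B + card ?C))"
      using card_Un_le[of G "?A \<union> (?B \<union> ?C)"] card_Un_le[of ?A "?B \<union> ?C"] card_Un_le[of ?B ?C] by linarith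
    also have "\<dots> \<le> 7 * q * (q + 1)\<^sup>2 + 2 * ((q\<^sup>2 + q + 1) * (q + 1)) + (q + 1) * (q + 1)\<^sup>2"
      using A B C G by linarith
    also have "(q\<^sup>2 + q + 1) * (q + 1) \<le> (q + 1) * (q + 1)\<^sup>2"
      by (simp add: power2_eq_square algebra_simps)
    then have "7 * q * (q + 1)\<^sup>2 + 2 * ((q\<^sup>2 + q + 1) * (q + 1)) + (q + 1) * (q + 1)\<^sup>2 \<le>
        (10 * q + 3) * (q + 1)\<^sup>2"
      by (simp add: algebra_simps)
    also have "\<dots> \<le> (11 * q) * (q + 1)\<^sup>2" using q43 by (intro mult_right_mono) auto
    finally show ?thesis .
  qed
qed

end

section \<open>Covering lines by points and planes\<close>

text \<open>Here \<open>a\<close> points and \<open>b\<close> planes leave \<open>u\<close> lines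
  uncovered, and \<open>k\<close>, \<open>r\<close> are quotient and residue of
  \<open>b + 1 + s\<close> by \<open>q\<close>, with \<open>r\<close> between \<open>1\<close> and
  \<open>q\<close>. Eliminating \<open>b\<close> from \<open>ineq\<close> leaves the product
  \<open>(k + 1) * (a - 1)\<close>, which is bounded because \<open>q * (k + 1)\<close> and
  \<open>a - 1\<close> have a known sum.\<close>

lemma covering_arith:
  fixes q a b s k r u :: int
  assumes q: "q \<ge> 47" and r: "1 \<le> r" and s: "s \<ge> 0"
    and k: "b + 1 + s = k * q + r" and sum: "a + b + s + 1 = q\<^sup>2 + q" and u: "u \<le> 11 * q * s"
    and ineq: "r * (k + 1) * (q^3 + q\<^sup>2 + q + 1 - a) \<le> r * b * (q\<^sup>2 + q + 1) + (q + 1) * u"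
    and rq: "r \<le> q"
  shows "r * (3 * q + 1 - 4 * r) \<le> 4 * s * (11 - r)"
proof -
  define D where "D = q\<^sup>2 + q + 1"
  have D: "D > 0" using q by (simp add: D_def add_pos_pos)
  have b: "b = k * q + r - 1 - s" using k by simp
  have "(q + 1) * u \<le> (q + 1) * (11 * q * s)" using u q by (intro mult_left_mono) auto
  also have "\<dots> \<le> 11 * (D * s)" using q s by (simp add: D_def power2_eq_square algebra_simps)
  finally have u': "(q + 1) * u \<le> 11 * (D * s)" .
  have e: "q^3 + q\<^sup>2 + q + 1 - a = q * D + 1 - a"
    by (simp add: D_def power2_eq_square power3_eq_cube algebra_simps)
  have "r * (k + 1) * (q * D + 1 - a) \<le> r * b * D + 11 * (D * s)"
    using ineq u' unfolding e D_def[symmetric] by linarith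
  then have 1: "r * D * (q - r + 1 + s) \<le> r * ((k + 1) * (a - 1)) + 11 * (D * s)"
    unfolding b by (simp add: algebra_simps)
  \<comment> \<open>Arithmetic-geometric mean inequality for \<open>q * (k + 1)\<close> and
    \<open>a - 1\<close>.\<close>
  have "0 \<le> (q * (k + 1) - (a - 1))\<^sup>2" by simp
  then have "q * (4 * ((k + 1) * (a - 1))) \<le> (q * (k + 1) + (a - 1))\<^sup>2"
    by (simp add: power2_eq_square algebra_simps)
  also have "q * (k + 1) + (a - 1) = q\<^sup>2 + 2 * q - 1 - r" using k sum by (simp add: algebra_simps)
  also have "(q\<^sup>2 + 2 * q - 1 - r)\<^sup>2 \<le> (q\<^sup>2 + 2 * q - 2)\<^sup>2"
  proof (rule power_mono)
    have "0 \<le> q\<^sup>2" by simp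
    then show "0 \<le> q\<^sup>2 + 2 * q - 1 - r" using r rq q by linarith
  qed (use r in simp)
  also have "\<dots> \<le> q * ((q + 3) * D)"
  proof -
    have "q * ((q + 3) * D) = (q\<^sup>2 + 2 * q - 2)\<^sup>2 + 4 * q\<^sup>2 + 11 * q - 4"
      by (simp add: D_def power2_eq_square algebra_simps)
    moreover have "0 \<le> q\<^sup>2" by simp
    ultimately show ?thesis using q by linarith
  qed
  finally have "4 * ((k + 1) * (a - 1)) \<le> (q + 3) * D" using q by simp
  then have "r * (4 * ((k + 1) * (a - 1))) \<le> r * ((q + 3) * D)" using r by (intro mult_left_mono) auto
  then have "D * (4 * r * (q - r + 1 + s)) \<le> D * (r * (q + 3) + 44 * s)"
    using 1 by (simp add: algebra_simps)
  then have "4 * r * (q - r + 1 + s) \<le> r * (q + 3) + 44 * s" using D by simp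
  then show ?thesis by (simp add: algebra_simps)
qed

text \<open>The unrounded form of the same estimate. With \<open>t = b + 1 + s\<close>, the product
  \<open>4 * t * (a - 1)\<close> is at most \<open>(q^2 + q - 1)^2\<close>, about
  \<open>q^4\<close>, whereas \<open>2 * s \<ge> q - 1\<close> would make it at least about
  \<open>2 * q^4\<close>.\<close>

lemma covering_arith_small:
  fixes q a b s u :: int
  assumes q: "q \<ge> 47" and s: "s \<ge> 0" and sum: "a + b + s + 1 = q\<^sup>2 + q" and u: "u \<le> 11 * q * s"
    and ineq: "(b + 1 + s) * (q^3 + q\<^sup>2 + q + 1 - a) \<le> q * b * (q\<^sup>2 + q + 1) + (q + 1) * u"
  shows "2 * s < q - 1"
proof (rule ccontr)
  assume "\<not> 2 * s < q - 1"
  then have s2: "2 * s \<ge> q - 1" by simp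
  define t where "t = b + 1 + s"
  have b: "b = t - 1 - s" by (simp add: t_def)
  \<comment> \<open>What remains of \<open>q^2 + q + 1\<close> after subtracting
    \<open>11 * (q + 1)\<close> for the uncovered lines.\<close>
  define E where "E = q\<^sup>2 - 10 * q - 10"
  have "q * 47 \<le> q * q" using q by (intro mult_left_mono) auto
  then have E: "E > 0" using q unfolding E_def power2_eq_square by linarith
  have "(q + 1) * u \<le> (q + 1) * (11 * q * s)" using u q by (intro mult_left_mono) auto
  then have "q * (1 + s) * (q\<^sup>2 + q + 1) \<le> t * (a - 1) + 11 * q * (q + 1) * s"
    using ineq unfolding t_def[symmetric] unfolding b
    by (simp add: power2_eq_square power3_eq_cube algebra_simps)
  then have 1: "4 * q * (q\<^sup>2 + q + 1) + 2 * q * (2 * s) * E \<le> 4 * (t * (a - 1))"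
    by (simp add: E_def power2_eq_square algebra_simps)
  have "0 \<le> (t - (a - 1))\<^sup>2" by simp
  then have "4 * (t * (a - 1)) \<le> (t + (a - 1))\<^sup>2" by (simp add: power2_eq_square algebra_simps)
  also have "t + (a - 1) = q\<^sup>2 + q - 1" using sum by (simp add: t_def)
  finally have 2: "4 * (t * (a - 1)) \<le> (q\<^sup>2 + q - 1)\<^sup>2" .
  have "2 * q * (q - 1) * E \<le> 2 * q * (2 * s) * E"
    using s2 q E by (intro mult_right_mono mult_left_mono) auto
  then have "4 * q * (q\<^sup>2 + q + 1) + 2 * q * (q - 1) * E \<le> (q\<^sup>2 + q - 1)\<^sup>2" using 1 2 by linarith
  then have "q * q * q * q + 5 * (q * q) + 26 * q \<le> 20 * (q * q * q) + 1"
    by (simp add: E_def power2_eq_square algebra_simps)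
  moreover have "47 * (q * q * q) \<le> q * (q * q * q)" using q by (intro mult_right_mono) auto
  moreover have "q * q * q > 0" "q * q > 0" using q by simp_all
  ultimately show False using q by (simp add: algebra_simps)
qed

text \<open>A residue of at least \<open>11\<close> makes the right side of its inequality
  nonpositive and so is at least \<open>(3 * q + 1) / 4\<close>; a residue \<open>x\<close> of at
  most \<open>10\<close> needs \<open>s \<ge> 2 * x\<close>. Neither size is compatible with the sum
  being \<open>s + 1\<close> modulo \<open>q\<close> and \<open>2 * s < q - 1\<close>.\<close>

lemma residue_contradiction:
  fixes q r r' s j :: int
  assumes q: "q \<ge> 47" and s: "0 \<le> s" "2 * s < q - 1"
    and r: "1 \<le> r" "r \<le> q" "1 \<le> r'" "r' \<le> q" and sum: "r + r' = s + 1 + q * j"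
    and i: "r * (3 * q + 1 - 4 * r) \<le> 4 * s * (11 - r)"
    and i': "r' * (3 * q + 1 - 4 * r') \<le> 4 * s * (11 - r')"
  shows False
proof -
  have j: "j = 0 \<or> j = 1"
  proof -
    have "\<not> j < 0"
    proof
      assume "j < 0"
      then have "q * j \<le> q * (-1)" using q by (intro mult_left_mono) auto
      then show False using sum r s by linarith
    qed
    moreover have "\<not> j \<ge> 2"
    proof
      assume "j \<ge> 2"
      then have "q * 2 \<le> q * j" using q by (intro mult_left_mono) auto
      then show False using sum r s by linarith
    qed
    ultimately show ?thesis by auto
  qed
  have large: "4 * x \<ge> 3 * q + 1"
    if "x \<ge> 11" "x * (3 * q + 1 - 4 * x) \<le> 4 * s * (11 - x)" for x
  proof -
    have "4 * s * (11 - x) \<le> 0" using that s by (simp add: mult_nonneg_nonpos)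
    then have "x * (3 * q + 1 - 4 * x) \<le> 0" using that by linarith
    then show ?thesis using that by (simp add: mult_le_0_iff)
  qed
  have small: False if x: "1 \<le> x" "x \<le> 10" "s \<le> 2 * x - 1" "x * (3 * q + 1 - 4 * x) \<le> 4 * s * (11 - x)" for x
  proof -
    \<comment> \<open>The constant is \<open>3 * 47 + 1 - 4 * 10\<close>.\<close>
    have "x * 102 \<le> x * (3 * q + 1 - 4 * x)" using x q by (intro mult_left_mono) auto
    also have "\<dots> \<le> 4 * s * (11 - x)" by (fact x(4))
    also have "\<dots> \<le> 4 * (2 * x - 1) * (11 - x)" using x by (intro mult_right_mono) auto
    also have "\<dots> \<le> 4 * (2 * x - 1) * 10" using x by (intro mult_left_mono) auto
    finally show False using x by simp
  qed
  show False
  proof (cases "r \<le> 10"; cases "r' \<le> 10")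
    assume "r \<le> 10" "r' \<le> 10"
    then have "s + 1 = r + r'" using j sum r s q by auto
    then have "s \<le> 2 * r - 1 \<or> s \<le> 2 * r' - 1" by linarith
    then show False using small[of r] small[of r'] i i' r \<open>r \<le> 10\<close> \<open>r' \<le> 10\<close> by blast
  next
    assume a: "r \<le> 10" "\<not> r' \<le> 10"
    then have "4 * r' \<ge> 3 * q + 1" using large[of r'] i' by simp
    \<comment> \<open>If \<open>j = 0\<close>, then \<open>s \<ge> r'\<close>, too large for
      \<open>2 * s < q - 1\<close>; so \<open>j = 1\<close> and even
      \<open>s \<le> r - 1\<close>.\<close>
    then have "s \<le> 2 * r - 1" using j sum r s q by auto
    then show False using small[of r] i r a by blast
  next
    assume a: "\<not> r \<le> 10" "r' \<le> 10"
    then have "4 * r \<ge> 3 * q + 1" using large[of r] i by simp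
    then have "s \<le> 2 * r' - 1" using j sum r s q by auto
    then show False using small[of r'] i' r a by blast
  next
    assume a: "\<not> r \<le> 10" "\<not> r' \<le> 10"
    then have "4 * r \<ge> 3 * q + 1" "4 * r' \<ge> 3 * q + 1" using large[of r] large[of r'] i i' by simp_all
    then show False using j sum r s q by auto
  qed
qed

section \<open>Lines missed by a set of points and planes, and colourings\<close>

context pg3 begin

definition uncovered where
  "uncovered A B = {l\<in>Ln. \<not> (\<exists>P\<in>A. P \<sqsubseteq> l) \<and> \<not> (\<exists>h\<in>B. l \<sqsubseteq> h)}"

text \<open>Each plane after the first shares a line through \<open>R\<close> with an earlier one,
  so it adds at most \<open>q\<close> new lines to the \<open>q + 1\<close> of the first.\<close>

lemma card_pencils_le:
  assumes R: "R \<in> Pt" and B: "finite B" "\<And>h. h \<in> B \<Longrightarrow> h \<in> Pl \<and> R \<sqsubseteq> h"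
  shows "card (\<Union>h\<in>B. {l\<in>Ln. R \<sqsubseteq> l \<and> l \<sqsubseteq> h}) \<le> q * card B + 1"
  using B
proof (induction B rule: finite_induct)
  case (insert h B)
  let ?S = "\<lambda>h. {l\<in>Ln. R \<sqsubseteq> l \<and> l \<sqsubseteq> h}"
  have h: "h \<in> Pl" "R \<sqsubseteq> h" using insert.prems by auto
  show ?case
  proof (cases "B = {}")
    case True
    then show ?thesis using lines_on_flag[OF R h] by simp
  next
    case False
    then obtain h' where h': "h' \<in> B" "h' \<in> Pl" "R \<sqsubseteq> h'" "h \<noteq> h'"
      using insert by blast
    obtain m where m: "m \<in> Ln" "m \<sqsubseteq> h" "m \<sqsubseteq> h'" using planes_line[OF h(1) h'(2,4)] by blast
    have "R \<sqsubseteq> m" using point_on_line[OF R m(1) h(1) h'(2,4) m(2,3) h(2) h'(3)] .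
    then have "card (?S h - \<Union>(?S ` B)) \<le> card (?S h - {m})"
      using m h' finite_Ln by (intro card_mono) auto
    also have "\<dots> = q" using lines_on_flag[OF R h] \<open>R \<sqsubseteq> m\<close> m by simp
    finally have "card (?S h - \<Union>(?S ` B)) \<le> q" .
    moreover have "card (\<Union>(?S ` B)) \<le> q * card B + 1" by (rule insert.IH) (use insert.prems in blast)
    ultimately have "card (\<Union>(?S ` B) \<union> (?S h - \<Union>(?S ` B))) \<le> (q * card B + 1) + q"
      using card_Un_le[of "\<Union>(?S ` B)" "?S h - \<Union>(?S ` B)"] by linarith
    moreover have "\<Union>(?S ` B) \<union> (?S h - \<Union>(?S ` B)) = \<Union>(?S ` insert h B)" by auto
    moreover have "card (insert h B) = card B + 1" using insert.hyps by simp
    ultimately show ?thesis by simp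
  qed
qed simp

text \<open>Of the \<open>q^2 + q + 1\<close> lines through \<open>R\<close>, each point of
  \<open>A\<close> covers at most one, and the planes of \<open>B\<close> on \<open>R\<close> are
  handled by \<open>card_pencils_le\<close>, whose extra \<open>1\<close> cancels.\<close>

lemma uncovered_through_point:
  assumes A: "A \<subseteq> Pt" and B: "B \<subseteq> Pl" and R: "R \<in> Pt - A"
  shows "q\<^sup>2 + q \<le> card A + q * card {h\<in>B. R \<sqsubseteq> h} + card {l\<in>uncovered A B. R \<sqsubseteq> l}"
proof -
  let ?B = "{h\<in>B. R \<sqsubseteq> h}" and ?U = "{l\<in>uncovered A B. R \<sqsubseteq> l}"
  let ?S = "\<Union>h\<in>?B. {l\<in>Ln. R \<sqsubseteq> l \<and> l \<sqsubseteq> h}"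
  have fin: "finite A" "finite B" using A B finite_Pt finite_Pl finite_subset by blast+
  have U: "finite (uncovered A B)" using finite_Ln by (simp add: uncovered_def)
  have "{l\<in>Ln. R \<sqsubseteq> l} \<subseteq> join R ` A \<union> ?S \<union> ?U"
  proof
    fix l assume l: "l \<in> {l\<in>Ln. R \<sqsubseteq> l}"
    show "l \<in> join R ` A \<union> ?S \<union> ?U"
    proof (cases "\<exists>P\<in>A. P \<sqsubseteq> l")
      case True
      then obtain P where P: "P \<in> A" "P \<sqsubseteq> l" by blast
      then have "join R P = l" using join_eq[of R P l] l R A by blast
      then show ?thesis using P by blast
    next
      case False
      then show ?thesis using l le_trans unfolding uncovered_def by blast
    qed
  qed
  then have "card {l\<in>Ln. R \<sqsubseteq> l} \<le> card (join R ` A \<union> ?S \<union> ?U)"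
    by (rule card_mono[rotated]) (use fin U finite_Ln in auto)
  also have "\<dots> \<le> card (join R ` A) + card ?S + card ?U"
    using card_Un_le[of "join R ` A \<union> ?S" ?U] card_Un_le[of "join R ` A" ?S] by linarith
  also have "\<dots> \<le> card A + (q * card ?B + 1) + card ?U"
  proof (intro add_mono order_refl)
    show "card (join R ` A) \<le> card A" by (rule card_image_le[OF fin(1)])
    show "card ?S \<le> q * card ?B + 1" by (rule card_pencils_le) (use R fin B in auto)
  qed
  finally show ?thesis using lines_on_point[of R] R by simp
qed

text \<open>Any linear consequence \<open>z\<close> of the local count is summed over the points off
  \<open>A\<close>, and incidences with planes of \<open>B\<close> and uncovered lines are double
  counted. It is used once with rounding and once without.\<close>

lemma covering_inequality:
  assumes A: "A \<subseteq> Pt" and B: "B \<subseteq> Pl"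
    and z: "\<And>b u. q\<^sup>2 + q \<le> card A + q * b + u \<Longrightarrow> z \<le> r * b + u"
  shows "z * (card Pt - card A) \<le> r * card B * (q\<^sup>2 + q + 1) + (q + 1) * card (uncovered A B)"
proof -
  let ?b = "\<lambda>R. card {h\<in>B. R \<sqsubseteq> h}" and ?u = "\<lambda>R. card {l\<in>uncovered A B. R \<sqsubseteq> l}"
  have fin: "finite A" "finite B" using A B finite_Pt finite_Pl finite_subset by blast+
  have U: "finite (uncovered A B)" using finite_Ln by (simp add: uncovered_def)
  have "z * (card Pt - card A) = (\<Sum>R\<in>Pt - A. z)" using A fin by (simp add: card_Diff_subset)
  also have "\<dots> \<le> (\<Sum>R\<in>Pt - A. r * ?b R + ?u R)"
    by (intro sum_mono z uncovered_through_point[OF A B])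
  also have "\<dots> \<le> (\<Sum>R\<in>Pt. r * ?b R + ?u R)" by (rule sum_mono2) (use finite_Pt in auto)
  also have "\<dots> = r * (\<Sum>R\<in>Pt. ?b R) + (\<Sum>R\<in>Pt. ?u R)" by (simp add: sum.distrib sum_distrib_left)
  also have "(\<Sum>R\<in>Pt. ?b R) = (\<Sum>h\<in>B. card {R\<in>Pt. R \<sqsubseteq> h})"
    by (rule sum_card_swap[OF finite_Pt fin(2)])
  also have "\<dots> = card B * (q\<^sup>2 + q + 1)" by (simp add: points_on_plane subsetD[OF B])
  also have "(\<Sum>R\<in>Pt. ?u R) = (\<Sum>l\<in>uncovered A B. card {R\<in>Pt. R \<sqsubseteq> l})"
    by (rule sum_card_swap[OF finite_Pt U])
  also have "\<dots> = (q + 1) * card (uncovered A B)" by (simp add: points_on_line uncovered_def)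
  finally show ?thesis by (simp add: algebra_simps)
qed

text \<open>The number of planes of \<open>B\<close> through a point off \<open>A\<close> is at least \<open>(card B + 1 + s) / q\<close>, up to
  uncovered lines; the gain comes from rounding this up to an integer.\<close>

lemma covering_residue:
  fixes s :: nat and r :: int
  assumes A: "A \<subseteq> Pt" and B: "B \<subseteq> Pl" and q47: "q \<ge> 47"
    and sum: "card A + card B + s + 1 = q\<^sup>2 + q" and U: "card (uncovered A B) \<le> 11 * q * s"
  defines "r \<equiv> int ((card B + s) mod q) + 1"
  shows "r * (3 * q + 1 - 4 * r) \<le> 4 * s * (11 - r)" and "2 * int s < int q - 1"
proof -
  define k where "k = (card B + s) div q"
  \<comment> \<open>The representative of \<open>card B + 1 + s\<close> modulo \<open>q\<close>
    between \<open>1\<close> and \<open>q\<close>, so that \<open>k + 1\<close> is the quotient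
    rounded up.\<close>
  define t where "t = (card B + s) mod q + 1"
  have k: "card B + 1 + s = k * q + t" by (simp add: k_def t_def)
  have tq: "t \<le> q" using q47 by (simp add: t_def Suc_le_eq)
  have cA: "card A \<le> card Pt" using card_mono[OF finite_Pt A] .
  have N: "int (card Pt - card A) = int q ^ 3 + (int q)\<^sup>2 + int q + 1 - int (card A)"
    using cA by (simp add: of_nat_diff card_Pt)
  \<comment> \<open>Rounding that tolerates uncovered lines: a point on only \<open>k - j\<close>
    planes of \<open>B\<close> has at least \<open>q * j + t\<close> uncovered lines, and this is at
    least \<open>t * (j + 1)\<close>.\<close>
  have "t * (k + 1) \<le> t * b + u" if "q\<^sup>2 + q \<le> card A + q * b + u" for b u
  proof (cases "k + 1 \<le> b")
    case True
    then have "t * (k + 1) \<le> t * b" by (rule mult_left_mono) simp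
    then show ?thesis by simp
  next
    case False
    then obtain j where j: "k = b + j" by (metis Suc_eq_plus1 less_Suc_eq_le not_le le_iff_add)
    have "k * q + t \<le> q * b + u" using that k sum by simp
    then have "q * j + t \<le> u" unfolding j by (simp add: algebra_simps)
    moreover have "t * j \<le> q * j" using tq by (rule mult_right_mono) simp
    moreover have "t * (k + 1) = t * b + t * j + t" unfolding j by (simp add: algebra_simps)
    ultimately show ?thesis by linarith
  qed
  from covering_inequality[OF A B this]
  have "int (t * (k + 1) * (card Pt - card A)) \<le>
      int (t * card B * (q\<^sup>2 + q + 1) + (q + 1) * card (uncovered A B))" by (simp only: of_nat_le_iff)
  then have "int t * (int k + 1) * (int q ^ 3 + (int q)\<^sup>2 + int q + 1 - int (card A)) \<le>
      int t * int (card B) * ((int q)\<^sup>2 + int q + 1) + (int q + 1) * int (card (uncovered A B))"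
    by (simp only: of_nat_mult of_nat_add of_nat_power of_nat_1 N)
  moreover have "int (card B) + 1 + int s = int k * int q + int t" using k by (metis of_nat_add of_nat_mult of_nat_1)
  moreover have sum': "int (card A) + int (card B) + int s + 1 = (int q)\<^sup>2 + int q"
    using sum by (metis of_nat_add of_nat_power of_nat_1)
  moreover have U': "int (card (uncovered A B)) \<le> 11 * int q * int s"
    using U by (metis of_nat_le_iff of_nat_mult of_nat_numeral)
  ultimately have "int t * (3 * int q + 1 - 4 * int t) \<le> 4 * int s * (11 - int t)"
    using q47 tq by (intro covering_arith) (auto simp: t_def)
  then show "r * (3 * q + 1 - 4 * r) \<le> 4 * s * (11 - r)" by (simp add: r_def t_def algebra_simps)
  \<comment> \<open>The unrounded count, with multiplier \<open>q\<close> in place of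
    \<open>t\<close>, bounds \<open>s\<close>.\<close>
  have "card B + 1 + s \<le> q * b + u" if "q\<^sup>2 + q \<le> card A + q * b + u" for b u
    using that sum by simp
  from covering_inequality[OF A B this]
  have "int ((card B + 1 + s) * (card Pt - card A)) \<le>
      int (q * card B * (q\<^sup>2 + q + 1) + (q + 1) * card (uncovered A B))" by (simp only: of_nat_le_iff)
  then have "(int (card B) + 1 + int s) * (int q ^ 3 + (int q)\<^sup>2 + int q + 1 - int (card A)) \<le>
      int q * int (card B) * ((int q)\<^sup>2 + int q + 1) + (int q + 1) * int (card (uncovered A B))"
    by (simp only: of_nat_mult of_nat_add of_nat_power of_nat_1 N)
  then show "2 * int s < int q - 1"
    using q47 sum' U' by (intro covering_arith_small) auto
qed

text \<open>\<open>covering_residue\<close> is applied in the space and in its dual. The two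
  residues belong to \<open>card B + 1 + s\<close> and \<open>card A + 1 + s\<close>, whose sum
  \<open>q^2 + q + 1 + s\<close> is \<open>s + 1\<close> modulo \<open>q\<close>.\<close>

lemma card_uncovered_gt:
  assumes A: "A \<subseteq> Pt" and B: "B \<subseteq> Pl" and q47: "q \<ge> 47"
    and sum: "card A + card B + s + 1 = q\<^sup>2 + q"
  shows "card (uncovered A B) > 11 * q * s"
proof (rule ccontr)
  assume "\<not> card (uncovered A B) > 11 * q * s"
  then have U: "card (uncovered A B) \<le> 11 * q * s" by simp
  interpret D: pg3 Pl Ln Pt "\<lambda>x y. y \<sqsubseteq> x" q by (rule dual)
  have "D.uncovered B A = uncovered A B" by (auto simp: D.uncovered_def uncovered_def)
  then have U': "card (D.uncovered B A) \<le> 11 * q * s" using U by simp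
  have sum': "card B + card A + s + 1 = q\<^sup>2 + q" using sum by simp
  let ?r = "int ((card B + s) mod q) + 1" and ?r' = "int ((card A + s) mod q) + 1"
  let ?k = "(card B + s) div q" and ?k' = "(card A + s) div q"
  have e: "int (card B + s) = int ?k * int q + (?r - 1)" "int (card A + s) = int ?k' * int q + (?r' - 1)"
    by (metis add_diff_cancel_right' div_mult_mod_eq of_nat_add of_nat_mult)+
  have s: "int (card A) + int (card B) + int s + 1 = int q * int q + int q"
    using sum by (metis of_nat_add of_nat_mult of_nat_1 power2_eq_square)
  have "?r + ?r' = int s + 1 + int q * (int q + 1 - int ?k - int ?k')"
    using e s by (simp add: algebra_simps)
  moreover have "int (n mod q) + 1 \<le> int q" for n
  proof -
    have "n mod q < q" using q47 by simp
    then show ?thesis by (simp only: add1_zle_eq of_nat_less_iff)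
  qed
  ultimately show False
    using residue_contradiction[of "int q" "int s" ?r ?r'] q47
      covering_residue[OF A B q47 sum U] D.covering_residue[OF B A q47 sum' U'] by auto
qed

text \<open>A colour class lies in a point star, in a plane star, or is small. All
  \<open>(q + 1)^2\<close> chambers on a line missed by the chosen points and planes have colours of
  small classes, so \<open>crossing_bound\<close> allows at most \<open>11 * q\<close> such lines
  per small class, contradicting \<open>card_uncovered_gt\<close>.\<close>

lemma colours_lower_bound:
  fixes col :: "'f \<times> 'f \<times> 'f \<Rightarrow> nat"
  assumes q47: "q \<ge> 47" and col: "\<And>c. c \<in> chamb \<Longrightarrow> col c < k"
    and proper: "\<And>i. crossing {c\<in>chamb. col c = i}"
  shows "q\<^sup>2 + q \<le> k"
proof (rule ccontr)
  assume n: "\<not> q\<^sup>2 + q \<le> k"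
  let ?C = "\<lambda>i. {c\<in>chamb. col c = i}"
  let ?p = "\<lambda>i X. X \<in> Pt \<and> (\<forall>c\<in>?C i. X \<sqsubseteq> lin c)" and ?h = "\<lambda>i h. h \<in> Pl \<and> (\<forall>c\<in>?C i. lin c \<sqsubseteq> h)"
  \<comment> \<open>An empty class also lands in \<open>IA\<close>, with an arbitrary point; a class
    in both a point star and a plane star is counted only here.\<close>
  define IA where "IA = {i\<in>{..<k}. \<exists>X. ?p i X}"
  define IB where "IB = {i\<in>{..<k}. (\<nexists>X. ?p i X) \<and> (\<exists>h. ?h i h)}"
  define IS where "IS = {i\<in>{..<k}. (\<nexists>X. ?p i X) \<and> (\<nexists>h. ?h i h)}"
  define f where "f i = (SOME X. ?p i X)" for i
  define g where "g i = (SOME h. ?h i h)" for i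
  have f: "?p i (f i)" if "i \<in> IA" for i 
  proof -
    have "\<exists>X. ?p i X" using that unfolding IA_def by blast
    then show ?thesis unfolding f_def by (rule someI_ex)
  qed
  have g: "?h i (g i)" if "i \<in> IB" for i 
  proof -
    have "\<exists>h. ?h i h" using that unfolding IB_def by blast
    then show ?thesis unfolding g_def by (rule someI_ex)
  qed
  have fin: "finite IA" "finite IB" "finite IS" by (simp_all add: IA_def IB_def IS_def)
  have "card (IA \<union> (IB \<union> IS)) = card IA + (card IB + card IS)"
  proof -
    have "IA \<inter> (IB \<union> IS) = {}" "IB \<inter> IS = {}" unfolding IA_def IB_def IS_def by blast+
    then show ?thesis using fin by (simp add: card_Un_disjoint)
  qed
  moreover have un: "IA \<union> (IB \<union> IS) = {..<k}" unfolding IA_def IB_def IS_def by blast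
  ultimately have "card IA + (card IB + card IS) = k" by simp
  then have le: "card (f ` IA) + card (g ` IB) + card IS + 1 \<le> q\<^sup>2 + q"
    using n card_image_le[OF fin(1), of f] card_image_le[OF fin(2), of g] by linarith
  \<comment> \<open>The slack \<open>s\<close> makes the sum exact: besides the small classes it
    absorbs repeated values of \<open>f\<close> and \<open>g\<close> and any further deficit of
    \<open>k\<close>.\<close>
  define s where "s = q\<^sup>2 + q - 1 - card (f ` IA) - card (g ` IB)"
  have s: "card (f ` IA) + card (g ` IB) + s + 1 = q\<^sup>2 + q" "card IS \<le> s"
    using le by (auto simp: s_def)
  let ?U = "uncovered (f ` IA) (g ` IB)"
  have "{c\<in>chamb. lin c \<in> ?U} \<subseteq> (\<Union>i\<in>IS. ?C i)"
  proof
    fix c assume c: "c \<in> {c\<in>chamb. lin c \<in> ?U}"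
    have "col c \<notin> IA" "col c \<notin> IB" using f[of "col c"] g[of "col c"] c unfolding uncovered_def by blast+
    moreover have "col c \<in> IA \<union> (IB \<union> IS)" using col[of c] c unfolding un by simp
    ultimately have "col c \<in> IS" by blast
    then show "c \<in> (\<Union>i\<in>IS. ?C i)" using c by blast
  qed
  then have "card {c\<in>chamb. lin c \<in> ?U} \<le> card (\<Union>i\<in>IS. ?C i)"
    by (rule card_mono[rotated]) (use fin finite_chamb in auto)
  also have "\<dots> \<le> (\<Sum>i\<in>IS. card (?C i))" by (rule card_UN_le[OF fin(3)])
  also have "\<dots> \<le> (\<Sum>i\<in>IS. 11 * q * (q + 1)\<^sup>2)"
  proof (intro sum_mono)
    fix i assume "i \<in> IS"
    then show "card (?C i) \<le> 11 * q * (q + 1)\<^sup>2"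
      using q47 by (intro crossing_bound[OF proper]) (auto simp: IS_def)
  qed
  also have "\<dots> = (11 * q * card IS) * (q + 1)\<^sup>2" by simp
  also have "\<dots> \<le> (11 * q * s) * (q + 1)\<^sup>2" using s(2) by (intro mult_right_mono mult_left_mono) auto
  finally have "card ?U * (q + 1)\<^sup>2 \<le> (11 * q * s) * (q + 1)\<^sup>2"
    using card_chamb_line_set[of ?U] by (simp add: uncovered_def)
  then have "card ?U \<le> 11 * q * s" by simp
  moreover have "f ` IA \<subseteq> Pt" "g ` IB \<subseteq> Pl" using f g by auto
  ultimately show False using card_uncovered_gt[OF _ _ q47 s(1)] by (meson not_le)
qed

text \<open>The colours are the points of a plane off a line \<open>g\<close> of it and the other planes through \<open>g\<close>.\<close>

lemma colouring_exists:
  "\<exists>col. (\<forall>c\<in>chamb. col c < q\<^sup>2 + q) \<and>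
    (\<forall>c\<in>chamb. \<forall>d\<in>chamb. col c = col d \<longrightarrow> meets (lin c) (lin d))"
proof -
  have "Pl \<noteq> {}" using card_Pl by auto
  then obtain \<tau> where \<tau>: "\<tau> \<in> Pl" by blast
  have "{P\<in>Pt. P \<sqsubseteq> \<tau>} \<noteq> {}" using points_on_plane[OF \<tau>] by (intro notI) (simp only: card.empty)
  then obtain P where P: "P \<in> Pt" "P \<sqsubseteq> \<tau>" by blast
  have "{l\<in>Ln. P \<sqsubseteq> l \<and> l \<sqsubseteq> \<tau>} \<noteq> {}"
    using lines_on_flag[OF P(1) \<tau> P(2)] by (intro notI) (simp only: card.empty)
  then obtain g where g: "g \<in> Ln" "g \<sqsubseteq> \<tau>" by blast
  \<comment> \<open>\<open>A\<close> has \<open>q^2\<close> points and \<open>B\<close> has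
    \<open>q\<close> planes, which gives the number of colours.\<close>
  define A where "A = {P\<in>Pt. P \<sqsubseteq> \<tau>} - {P\<in>Pt. P \<sqsubseteq> g}"
  define B where "B = {h\<in>Pl. g \<sqsubseteq> h} - {\<tau>}"
  have "{P\<in>Pt. P \<sqsubseteq> g} \<subseteq> {P\<in>Pt. P \<sqsubseteq> \<tau>}" using g le_trans by blast
  then have "card A = q\<^sup>2"
    unfolding A_def using finite_Pt by (simp add: card_Diff_subset points_on_plane[OF \<tau>] points_on_line[OF g(1)])
  moreover have B: "card B = q" unfolding B_def using \<tau> g by (simp add: planes_on_line)
  moreover have fin: "finite A" "finite B" using finite_Pt finite_Pl by (auto simp: A_def B_def)
  ultimately have "card (A <+> B) = q\<^sup>2 + q" by (simp add: card_Plus)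
  then obtain n where n: "bij_betw n (A <+> B) {..<q\<^sup>2 + q}"
    using ex_bij_betw_finite_nat[of "A <+> B"] fin by (metis finite_Plus atLeast0LessThan)
  let ?ok = "\<lambda>l x. case x of Inl P \<Rightarrow> P \<in> A \<and> P \<sqsubseteq> l | Inr h \<Rightarrow> h \<in> B \<and> l \<sqsubseteq> h"
  have ex: "\<exists>x. ?ok l x" if l: "l \<in> Ln" for l
  proof -
    have "(\<exists>P\<in>A. P \<sqsubseteq> l) \<or> (\<exists>h\<in>B. l \<sqsubseteq> h)"
    proof (cases "l = g")
      case True
      have "B \<noteq> {}" using B q2 by auto
      then show ?thesis using True by (auto simp: B_def)
    next
      case False
      obtain X where X: "X \<in> Pt" "X \<sqsubseteq> \<tau>" "X \<sqsubseteq> l" using point_ex[OF \<tau> l] by blast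
      show ?thesis
      proof (cases "X \<sqsubseteq> g")
        case True
        then obtain h where h: "h \<in> Pl" "l \<sqsubseteq> h" "g \<sqsubseteq> h"
          using coplanar_if_meets[OF l g(1)] X unfolding meets_def by blast
        obtain Q where Q: "Q \<in> Pt" "Q \<sqsubseteq> l" "Q \<noteq> X" using point_on_line_other[OF l] by blast
        then have "\<not> Q \<sqsubseteq> g" using line_unique[of Q X l g] X True l g False by blast
        \<comment> \<open>If \<open>l\<close> and \<open>g\<close> span \<open>\<tau>\<close>, the
          second point \<open>Q\<close> of \<open>l\<close> is a point of \<open>\<tau>\<close> off
          \<open>g\<close>; otherwise their span \<open>h\<close> belongs to
          \<open>B\<close>.\<close>
        then have "Q \<in> A \<or> h \<noteq> \<tau>" using Q h le_trans by (auto simp: A_def)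
        then show ?thesis using Q h by (auto simp: B_def)
      qed (use X in \<open>auto simp: A_def\<close>)
    qed
    then show ?thesis
    proof
      assume "\<exists>P\<in>A. P \<sqsubseteq> l"
      then obtain P where "?ok l (Inl P)" by auto
      then show ?thesis by blast
    next
      assume "\<exists>h\<in>B. l \<sqsubseteq> h"
      then obtain h where "?ok l (Inr h)" by auto
      then show ?thesis by blast
    qed
  qed
  define sel where "sel l = (SOME x. ?ok l x)" for l
  have sel: "?ok l (sel l)" if "l \<in> Ln" for l unfolding sel_def by (rule someI_ex[OF ex[OF that]])
  have sel_in: "sel l \<in> A <+> B" if "l \<in> Ln" for l using sel[OF that] by (auto split: sum.splits)
  have "n (sel (lin c)) < q\<^sup>2 + q" if "c \<in> chamb" for c
    using bij_betwE[OF n] sel_in[OF chambD(2)[OF that]] by auto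
  moreover have "meets (lin c) (lin d)"
    if "c \<in> chamb" "d \<in> chamb" "n (sel (lin c)) = n (sel (lin d))" for c d
  proof -
    note c = chambD(2)[OF that(1)] and d = chambD(2)[OF that(2)]
    have "sel (lin c) = sel (lin d)"
      using bij_betw_imp_inj_on[OF n] that(3) sel_in[OF c] sel_in[OF d] by (auto dest: inj_onD)
    then show ?thesis
    proof (cases "sel (lin c)")
      case (Inl P)
      then show ?thesis
        using \<open>sel (lin c) = sel (lin d)\<close> sel[OF c] sel[OF d] by (auto simp: A_def meets_def)
    next
      case (Inr h)
      then show ?thesis unfolding meets_iff_coplanar[OF c d]
        using \<open>sel (lin c) = sel (lin d)\<close> sel[OF c] sel[OF d] by (auto simp: B_def)
    qed
  qed
  ultimately show ?thesis by (intro exI[of _ "\<lambda>c. n (sel (lin c))"]) blast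
qed

end

section \<open>The space of subspaces of a 4-dimensional vector space\<close>

context pg3 begin

lemma crossing_point_star:
  assumes "X \<in> Pt"
  shows "crossing {c\<in>chamb. X \<sqsubseteq> lin c}" "card {c\<in>chamb. X \<sqsubseteq> lin c} = (q\<^sup>2 + q + 1) * (q + 1)\<^sup>2"
proof -
  show "crossing {c\<in>chamb. X \<sqsubseteq> lin c}" using assms by (auto simp: crossing_def meets_def)
  have "{c\<in>chamb. X \<sqsubseteq> lin c} = {c\<in>chamb. lin c \<in> {l\<in>Ln. X \<sqsubseteq> l}}" using chambD(2) by blast
  then show "card {c\<in>chamb. X \<sqsubseteq> lin c} = (q\<^sup>2 + q + 1) * (q + 1)\<^sup>2"
    using card_chamb_line_set[of "{l\<in>Ln. X \<sqsubseteq> l}"] lines_on_point[OF assms] by simp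
qed

lemma crossing_plane_star:
  assumes "h \<in> Pl"
  shows "crossing {c\<in>chamb. lin c \<sqsubseteq> h}" "card {c\<in>chamb. lin c \<sqsubseteq> h} = (q\<^sup>2 + q + 1) * (q + 1)\<^sup>2"
proof -
  interpret D: pg3 Pl Ln Pt "\<lambda>x y. y \<sqsubseteq> x" q by (rule dual)
  show "card {c\<in>chamb. lin c \<sqsubseteq> h} = (q\<^sup>2 + q + 1) * (q + 1)\<^sup>2"
    using D.crossing_point_star(2)[OF assms] unfolding flip_chamb card_flip_Collect by simp
  have "meets (lin c) (lin d)" if "c \<in> chamb" "d \<in> chamb" "lin c \<sqsubseteq> h" "lin d \<sqsubseteq> h" for c d
    using meets_iff_coplanar[OF chambD(2)[OF that(1)] chambD(2)[OF that(2)]] assms that by blast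
  then show "crossing {c\<in>chamb. lin c \<sqsubseteq> h}" unfolding crossing_def by blast
qed

end

text \<open>As \<open>b\<close> is outside the span of \<open>B\<close>, every vector of the larger
  span is uniquely \<open>k *s b + y\<close> with \<open>y\<close> in the span of
  \<open>B\<close>.\<close>

lemma card_span_independent:
  fixes B :: "('a::{field,finite}^'n) set"
  assumes "vec.independent B"
  shows "card (vec.span B) = CARD('a) ^ card B"
proof -
  have "finite B" by simp
  then show ?thesis using assms
  proof (induction B rule: finite_induct)
    case (insert b B)
    have b: "b \<notin> vec.span B" and B: "vec.independent B"
      using insert.prems insert.hyps by (auto simp: vec.independent_insert)
    let ?f = "\<lambda>(k, y). k *s b + y"
    have "vec.span (insert b B) = ?f ` (UNIV \<times> vec.span B)"
    proof (intro equalityI subsetI)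
      fix x assume "x \<in> vec.span (insert b B)"
      then obtain k where "x - k *s b \<in> vec.span B" by (auto simp: vec.span_breakdown_eq)
      then show "x \<in> ?f ` (UNIV \<times> vec.span B)" by (intro image_eqI[of _ _ "(k, x - k *s b)"]) auto
    next
      fix x assume "x \<in> ?f ` (UNIV \<times> vec.span B)"
      then obtain k y where "y \<in> vec.span B" "x = k *s b + y" by auto
      then have "x - k *s b \<in> vec.span B" by simp
      then show "x \<in> vec.span (insert b B)" unfolding vec.span_breakdown_eq by blast
    qed
    moreover have "inj_on ?f (UNIV \<times> vec.span B)"
    proof (rule inj_onI, clarify)
      fix k y k' y' assume y: "y \<in> vec.span B" "y' \<in> vec.span B" and e: "k *s b + y = k' *s b + y'"
      have "(k - k') *s b = y' - y" using e by (simp add: vec.scale_left_diff_distrib algebra_simps)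
      then have in_span: "(k - k') *s b \<in> vec.span B" using y by (simp add: vec.span_diff)
      have "k = k'"
      proof (rule ccontr)
        assume "k \<noteq> k'"
        then have "inverse (k - k') *s ((k - k') *s b) = b"
          by (simp only: vec.scale_scale left_inverse vec.scale_one right_minus_eq not_False_eq_True)
        then show False using vec.span_scale[OF in_span, of "inverse (k - k')"] b by simp
      qed
      then show "k = k' \<and> y = y'" using e by simp
    qed
    ultimately have "card (vec.span (insert b B)) = CARD('a) * card (vec.span B)"
      by (simp add: card_image card_cartesian_product)
    then show ?case using insert B by simp
  qed simp
qed

lemma card_subspace:
  fixes V :: "('a::{field,finite}^'n) set"
  assumes "vec.subspace V"
  shows "card V = CARD('a) ^ vec.dim V"
proof -
  obtain B where B: "B \<subseteq> V" "vec.independent B" "V \<subseteq> vec.span B" "card B = vec.dim V"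
    using vec.basis_exists by blast
  then have "vec.span B = V" using assms vec.span_minimal by blast
  then show ?thesis using card_span_independent[OF B(2)] B(4) by simp
qed

lemma field_card_ge_2: "CARD('a::{field,finite}) \<ge> 2"
proof -
  have "card {0, 1 :: 'a} \<le> CARD('a)" by (rule card_mono) auto
  then show ?thesis by simp
qed

lemma span_singleton_point:
  assumes "v \<noteq> (0 :: 'a::field^4)"
  shows "pg_point (vec.span {v})"
  using assms by (simp add: pg_point_def vec.subspace_span)

lemma point_eq_span:
  assumes "pg_point P" "v \<in> P" "v \<noteq> 0"
  shows "vec.span {v} = P"
proof (rule vec.subspace_dim_equal)
  show "vec.span {v} \<subseteq> P" using assms by (intro vec.span_minimal) (auto simp: pg_point_def)
qed (use assms in \<open>auto simp: pg_point_def vec.subspace_span\<close>)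

text \<open>Each point is spanned by any of its \<open>CARD('a) - 1\<close> nonzero vectors.\<close>

lemma card_points_in_subspace:
  fixes V :: "('a::{field,finite}^4) set"
  assumes V: "vec.subspace V"
  shows "card {P. pg_point P \<and> P \<subseteq> V} * (CARD('a) - 1) = CARD('a) ^ vec.dim V - 1"
proof -
  have "card (V - {0}) = card {P. pg_point P \<and> P \<subseteq> V} * (CARD('a) - 1)"
  proof (rule card_fibres[where f = "\<lambda>v. vec.span {v}"])
    show "(\<lambda>v. vec.span {v}) ` (V - {0}) \<subseteq> {P. pg_point P \<and> P \<subseteq> V}"
    proof (intro image_subsetI CollectI conjI)
      fix v assume v: "v \<in> V - {0}"
      show "pg_point (vec.span {v})" using v by (intro span_singleton_point) simp
      show "vec.span {v} \<subseteq> V" using v V by (intro vec.span_minimal) auto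
    qed
    fix P assume "P \<in> {P. pg_point P \<and> P \<subseteq> V}"
    then have P: "pg_point P" "P \<subseteq> V" by auto
    have "{v \<in> V - {0}. vec.span {v} = P} = P - {0}"
      using P point_eq_span[OF P(1)] vec.span_base by blast
    moreover have "0 \<in> P" using P vec.subspace_0 by (auto simp: pg_point_def)
    moreover have "card P = CARD('a)" using P card_subspace[of P] by (simp add: pg_point_def)
    ultimately show "card {v \<in> V - {0}. vec.span {v} = P} = CARD('a) - 1" by simp
  qed simp_all
  moreover have "card (V - {0}) = CARD('a) ^ vec.dim V - 1"
    using vec.subspace_0[OF V] card_subspace[OF V] by simp
  ultimately show ?thesis by simp
qed

text \<open>Reads off a count from its multiple by \<open>q - 1\<close>; \<open>m\<close> will be
  the geometric sum of powers of \<open>q\<close>.\<close>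

lemma cancel_geometric:
  fixes q n m :: nat
  assumes "q \<ge> 2" "n * (q - 1) = q ^ d - 1" "m * (q - 1) = q ^ d - 1"
  shows "n = m"
proof -
  have "n * (q - 1) = m * (q - 1)" using assms by simp
  then show ?thesis using assms(1) by auto
qed

section \<open>Sums of subspaces and the dimension formula\<close>

abbreviation sum_space :: "('a::field^'n) set \<Rightarrow> ('a^'n) set \<Rightarrow> ('a^'n) set" where
  "sum_space S T \<equiv> {x + y |x y. x \<in> S \<and> y \<in> T}"

lemma sum_space:
  assumes "vec.subspace S" "vec.subspace T"
  shows "vec.subspace (sum_space S T)" "S \<subseteq> sum_space S T" "T \<subseteq> sum_space S T"
    "vec.dim (sum_space S T) + vec.dim (S \<inter> T) = vec.dim S + vec.dim T"
proof -
  show "vec.subspace (sum_space S T)" by (rule vec.subspace_sums[OF assms])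
  show "S \<subseteq> sum_space S T" "T \<subseteq> sum_space S T"
    using vec.subspace_0[OF assms(1)] vec.subspace_0[OF assms(2)] by force+
qed (rule vec.dim_sums_Int[OF assms])

lemma sum_space_least:
  assumes "vec.subspace V" "S \<subseteq> V" "T \<subseteq> V"
  shows "sum_space S T \<subseteq> V"
  using assms by (auto intro: vec.subspace_add)

lemma dim_Int_point:
  assumes P: "pg_point P" and V: "vec.subspace V" "\<not> P \<subseteq> V"
  shows "vec.dim (P \<inter> V) = 0"
proof (rule ccontr)
  assume n: "vec.dim (P \<inter> V) \<noteq> 0"
  have s: "vec.subspace P" and "vec.dim P = 1" using P by (auto simp: pg_point_def)
  then have "vec.dim P \<le> vec.dim (P \<inter> V)" using n by linarith
  then have "P \<inter> V = P" by (intro vec.subspace_dim_equal vec.subspace_inter s V Int_lower1)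
  then show False using V by blast
qed

lemma dim_le_4: "vec.dim (S :: ('a::field^4) set) \<le> 4"
  using vec.dim_subset_UNIV[of S] by (simp add: vec.dimension_def card_cart_basis)

lemma dim_join_points:
  assumes "pg_point P" "pg_point Q" "P \<noteq> Q"
  shows "vec.dim (sum_space P Q) = 2"
proof -
  have sub: "vec.subspace P" "vec.subspace Q" using assms by (auto simp: pg_point_def)
  have d: "vec.dim P = 1" "vec.dim Q = 1" using assms by (auto simp: pg_point_def)
  then have "\<not> P \<subseteq> Q" using assms(3) vec.subspace_dim_equal[OF sub] by force
  then show ?thesis using sum_space(4)[OF sub] dim_Int_point[OF assms(1) sub(2)] d by linarith
qed

lemma join_points_subset:
  assumes "pg_point P" "pg_point Q" "P \<noteq> Q" "pg_line l" "P \<subseteq> l" "Q \<subseteq> l"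
  shows "sum_space P Q = l"
proof (rule vec.subspace_dim_equal)
  show "vec.subspace (sum_space P Q)" using assms by (intro sum_space) (auto simp: pg_point_def)
  show "sum_space P Q \<subseteq> l" using assms by (intro sum_space_least) (auto simp: pg_line_def)
  show "vec.dim l \<le> vec.dim (sum_space P Q)"
    using dim_join_points[OF assms(1-3)] assms(4) unfolding pg_line_def by linarith
qed (use assms in \<open>simp add: pg_line_def\<close>)

text \<open>The case numbers follow the order of the axioms of \<open>pg3\<close>. The incidence
  axioms rest on the dimension formula in dimension 4, the counts on
  \<open>card_points_in_subspace\<close>.\<close>

lemma pg3_subspaces:
  "pg3 {P :: 'a::{field,finite} flat. pg_point P} {l. pg_line l} {h. pg_plane h} (\<subseteq>) CARD('a)"
proof (unfold_locales, goal_cases)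
  case (6 P Q)
  then have s: "vec.subspace P" "vec.subspace Q" by (auto simp: pg_point_def)
  have "pg_line (sum_space P Q)"
    using 6 sum_space(1)[OF s] dim_join_points by (simp add: pg_line_def)
  then show ?case using sum_space(2,3)[OF s] by blast
next
  case (7 P Q l l')
  then show ?case using join_points_subset[of P Q l] join_points_subset[of P Q l'] by simp
next
  case (8 P l)
  then have s: "vec.subspace P" "vec.subspace l" and d: "vec.dim P = 1" "vec.dim l = 2"
    by (auto simp: pg_point_def pg_line_def)
  show ?case
  proof (cases "P \<subseteq> l")
    \<comment> \<open>A point on \<open>l\<close> puts no further condition on the plane, so any
      vector outside \<open>l\<close> completes \<open>l\<close> to one.\<close>
    case True
    have "l \<noteq> UNIV" using d vec_dim_card[where 'a='a and 'n=4] by auto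
    then obtain x where x: "x \<notin> l" by auto
    then have "pg_plane (vec.span (insert x l))"
      using s d by (simp add: pg_plane_def vec.subspace_span vec.dim_insert vec.span_eq_iff[THEN iffD2])
    moreover have "l \<subseteq> vec.span (insert x l)" using vec.span_superset by blast
    ultimately show ?thesis using True by blast
  next
    case False
    then have "vec.dim (P \<inter> l) = 0" using 8 s by (intro dim_Int_point) auto
    then have "vec.dim (sum_space P l) = 3" using sum_space(4)[OF s] d by linarith
    then have "pg_plane (sum_space P l)" using sum_space(1)[OF s] unfolding pg_plane_def by blast
    then show ?thesis using sum_space(2,3)[OF s] by blast
  qed
next
  case (9 h l)
  then have s: "vec.subspace h" "vec.subspace l" and d: "vec.dim h = 3" "vec.dim l = 2"
    by (auto simp: pg_plane_def pg_line_def)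
  \<comment> \<open>The intersection has dimension at least \<open>3 + 2 - 4\<close>.\<close>
  have "1 \<le> vec.dim (h \<inter> l)" using sum_space(4)[OF s] dim_le_4[of "sum_space h l"] d by linarith
  then obtain P where "vec.subspace P" "P \<subseteq> vec.span (h \<inter> l)" "vec.dim P = 1"
    by (rule vec.choose_subspace_of_subspace)
  moreover have "vec.span (h \<inter> l) = h \<inter> l" by (simp only: vec.span_eq_iff vec.subspace_inter s)
  ultimately show ?case by (auto simp: pg_point_def)
next
  case (10 P Q l h)
  then have "sum_space P Q = l" using join_points_subset by blast
  moreover have "sum_space P Q \<subseteq> h" using 10 by (intro sum_space_least) (auto simp: pg_plane_def)
  ultimately show ?case by simp
next
  case (11 h h')
  then have s: "vec.subspace h" "vec.subspace h'" and d: "vec.dim h = 3" "vec.dim h' = 3"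
    by (auto simp: pg_plane_def)
  have "2 \<le> vec.dim (h \<inter> h')" using sum_space(4)[OF s] dim_le_4[of "sum_space h h'"] d by linarith
  then obtain l where "vec.subspace l" "l \<subseteq> vec.span (h \<inter> h')" "vec.dim l = 2"
    by (rule vec.choose_subspace_of_subspace)
  moreover have "vec.span (h \<inter> h') = h \<inter> h'" by (simp only: vec.span_eq_iff vec.subspace_inter s)
  ultimately show ?case by (auto simp: pg_line_def)
next
  case (12 P l h h')
  then have s: "vec.subspace h" "vec.subspace h'" "vec.subspace l"
    and d: "vec.dim h = 3" "vec.dim h' = 3" "vec.dim l = 2"
    by (auto simp: pg_plane_def pg_line_def)
  \<comment> \<open>Distinct planes meet in dimension at most \<open>2\<close>, so \<open>l\<close>
    is their whole intersection.\<close>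
  have "\<not> vec.dim (h \<inter> h') \<ge> 3"
  proof
    assume "vec.dim (h \<inter> h') \<ge> 3"
    then have "h \<inter> h' = h" "h \<inter> h' = h'"
      using d by (intro vec.subspace_dim_equal vec.subspace_inter s Int_lower1 Int_lower2; simp)+
    then show False using 12 by blast
  qed
  then have "l = h \<inter> h'"
    using s d 12 by (intro vec.subspace_dim_equal vec.subspace_inter) auto
  then show ?case using 12 by blast
next
  case 13
  have "card {P :: 'a flat. pg_point P} * (CARD('a) - 1) = CARD('a) ^ 4 - 1"
    using card_points_in_subspace[of "UNIV :: ('a^4) set"] by (simp add: card_cart_basis)
  then show ?case
    by (rule cancel_geometric[OF field_card_ge_2])
      (simp add: diff_mult_distrib2 algebra_simps power2_eq_square power3_eq_cube power4_eq_xxxx)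
next
  case (14 l)
  then have "card {P. pg_point P \<and> P \<subseteq> l} * (CARD('a) - 1) = CARD('a) ^ 2 - 1"
    using card_points_in_subspace[of l] by (simp add: pg_line_def)
  then have "card {P. pg_point P \<and> P \<subseteq> l} = CARD('a) + 1"
    by (rule cancel_geometric[OF field_card_ge_2])
      (simp add: diff_mult_distrib2 algebra_simps power2_eq_square)
  then show ?case by simp
next
  case (15 h)
  then have "card {P. pg_point P \<and> P \<subseteq> h} * (CARD('a) - 1) = CARD('a) ^ 3 - 1"
    using card_points_in_subspace[of h] by (simp add: pg_plane_def)
  then have "card {P. pg_point P \<and> P \<subseteq> h} = (CARD('a))\<^sup>2 + CARD('a) + 1"
    by (rule cancel_geometric[OF field_card_ge_2])
      (simp add: diff_mult_distrib2 algebra_simps power2_eq_square power3_eq_cube)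
  then show ?case by simp
qed (use field_card_ge_2 in auto)


section \<open>Translation of chambers and opposition into the axiomatic space\<close>

context
  fixes q :: nat
  assumes q: "q = CARD('a::{field,finite})"
begin

interpretation pg3 "{P :: 'a flat. pg_point P}" "{l. pg_line l}" "{h. pg_plane h}" "(\<subseteq>)" q
  unfolding q by (rule pg3_subspaces)

text \<open>Incidence allows inclusion in either direction; comparing dimensions excludes the wrong
  one.\<close>

lemma incident_iff:
  fixes P l h :: "'a flat"
  shows "pg_point P \<Longrightarrow> pg_line l \<Longrightarrow> incident P l \<longleftrightarrow> P \<subseteq> l"
    and "pg_line l \<Longrightarrow> pg_plane h \<Longrightarrow> incident l h \<longleftrightarrow> l \<subseteq> h"
    and "pg_line l \<Longrightarrow> pg_plane h \<Longrightarrow> incident h l \<longleftrightarrow> l \<subseteq> h"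
    and "pg_point P \<Longrightarrow> pg_plane h \<Longrightarrow> incident P h \<longleftrightarrow> P \<subseteq> h"
proof -
  show "incident P l \<longleftrightarrow> P \<subseteq> l" if "pg_point P" "pg_line l"
  proof -
    have "\<not> l \<subseteq> P" using that vec.dim_subset[of l P] unfolding pg_point_def pg_line_def by linarith
    then show ?thesis by (simp add: incident_def)
  qed
  show *: "incident l h \<longleftrightarrow> l \<subseteq> h" if "pg_line l" "pg_plane h"
  proof -
    have "\<not> h \<subseteq> l" using that vec.dim_subset[of h l] unfolding pg_plane_def pg_line_def by linarith
    then show ?thesis by (simp add: incident_def)
  qed
  show "incident h l \<longleftrightarrow> l \<subseteq> h" if "pg_line l" "pg_plane h"
    using *[OF that] by (auto simp: incident_def)
  show "incident P h \<longleftrightarrow> P \<subseteq> h" if "pg_point P" "pg_plane h"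
  proof -
    have "\<not> h \<subseteq> P" using that vec.dim_subset[of h P] unfolding pg_plane_def pg_point_def by linarith
    then show ?thesis by (simp add: incident_def)
  qed
qed

lemma chambers_eq: "(chambers :: 'a chamber set) = chamb"
proof -
  have "(P, l, h) \<in> chambers \<longleftrightarrow> (P, l, h) \<in> chamb" for P l h :: "'a flat"
    unfolding chambers_def chamb_def by (simp add: incident_iff cong: conj_cong) blast
  then show ?thesis by auto
qed

text \<open>A common nonzero vector spans a common point, and a common point cannot lie inside the
  zero space.\<close>

lemma skew_iff:
  fixes l l' :: "'a flat"
  assumes "pg_line l" "pg_line l'"
  shows "skew l l' \<longleftrightarrow> \<not> meets l l'"
proof
  assume s: "skew l l'"
  show "\<not> meets l l'"
  proof
    assume "meets l l'"
    then obtain X where X: "pg_point X" "X \<subseteq> l" "X \<subseteq> l'" by (auto simp: meets_def)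
    then have "X \<subseteq> {0}" using s by (auto simp: skew_def)
    then have "vec.dim X \<le> vec.dim {0 :: 'a^4}" by (rule vec.dim_subset)
    moreover have "vec.dim {0 :: 'a^4} = 0" by simp
    ultimately show False using X(1) unfolding pg_point_def by linarith
  qed
next
  assume n: "\<not> meets l l'"
  have s: "vec.subspace l" "vec.subspace l'" using assms by (auto simp: pg_line_def)
  have "v = 0" if "v \<in> l" "v \<in> l'" for v
  proof (rule ccontr)
    assume "v \<noteq> 0"
    then have "pg_point (vec.span {v})" by (rule span_singleton_point)
    moreover have "vec.span {v} \<subseteq> l" "vec.span {v} \<subseteq> l'"
      using that s by (simp_all add: vec.span_minimal)
    ultimately show False using n by (auto simp: meets_def)
  qed
  then show "skew l l'" using s vec.subspace_0 by (auto simp: skew_def)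
qed

lemma opposite_iff:
  fixes c d :: "'a chamber"
  assumes "c \<in> chamb" "d \<in> chamb"
  shows "\<not> opposite c d \<longleftrightarrow> pnt c \<subseteq> pln d \<or> pnt d \<subseteq> pln c \<or> meets (lin c) (lin d)"
proof -
  obtain P l h P' l' h' where c: "c = (P, l, h)" "d = (P', l', h')" by (cases c; cases d)
  have "pg_point P" "pg_line l" "pg_plane h" "pg_point P'" "pg_line l'" "pg_plane h'"
    using assms unfolding c chamb_def by auto
  then show ?thesis unfolding c by (auto simp: incident_iff skew_iff)
qed

lemma independent_iff_crossing:
  "independent_set (chambers :: 'a chamber set) opposite S \<longleftrightarrow> crossing S"
proof -
  have "(\<not> opposite c d) = (pnt c \<subseteq> pln d \<or> pnt d \<subseteq> pln c \<or> meets (lin c) (lin d))"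
    if "S \<subseteq> chamb" "c \<in> S" "d \<in> S" for c d
    by (rule opposite_iff) (use that in blast)+
  then show ?thesis unfolding independent_set_def crossing_def chambers_eq by blast
qed

lemma chambers_on_point:
  assumes "pg_point x"
  shows "(chambers_on x :: 'a chamber set) = {c \<in> chamb. x \<subseteq> lin c}"
proof -
  have "(P, l, h) \<in> chambers_on x \<longleftrightarrow> (P, l, h) \<in> {c \<in> chamb. x \<subseteq> lin c}" for P l h :: "'a flat"
    unfolding chambers_on_def chambers_eq using assms incident_iff(1) by (auto simp: chamb_def)
  then show ?thesis by auto
qed

lemma chambers_on_plane:
  assumes "pg_plane x"
  shows "(chambers_on x :: 'a chamber set) = {c \<in> chamb. lin c \<subseteq> x}"
proof -
  have "(P, l, h) \<in> chambers_on x \<longleftrightarrow> (P, l, h) \<in> {c \<in> chamb. lin c \<subseteq> x}" for P l h :: "'a flat"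
    unfolding chambers_on_def chambers_eq using assms incident_iff(3) by (auto simp: chamb_def)
  then show ?thesis by auto
qed

lemma chambers_on_independent:
  assumes "pg_point x \<or> pg_plane x"
  shows "independent_set (chambers :: 'a chamber set) opposite (chambers_on x)"
    and "card (chambers_on x :: 'a chamber set) = (q\<^sup>2 + q + 1) * (q + 1)\<^sup>2"
proof -
  have "crossing (chambers_on x :: 'a chamber set) \<and>
      card (chambers_on x :: 'a chamber set) = (q\<^sup>2 + q + 1) * (q + 1)\<^sup>2"
    using assms
  proof
    assume x: "pg_point x"
    show ?thesis unfolding chambers_on_point[OF x] using crossing_point_star[of x] x by blast
  next
    assume x: "pg_plane x"
    show ?thesis unfolding chambers_on_plane[OF x] using crossing_plane_star[of x] x by blast
  qed
  then show "independent_set (chambers :: 'a chamber set) opposite (chambers_on x)"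
    "card (chambers_on x :: 'a chamber set) = (q\<^sup>2 + q + 1) * (q + 1)\<^sup>2"
    by (simp_all add: independent_iff_crossing)
qed

lemma independent_set_dichotomy:
  assumes "q \<ge> 43" and S: "independent_set (chambers :: 'a chamber set) opposite S"
  shows "(\<exists>x. (pg_point x \<or> pg_plane x) \<and> S \<subseteq> chambers_on x) \<or> card S \<le> 11 * q * (q + 1)\<^sup>2"
proof -
  have F: "crossing S" using S by (simp add: independent_iff_crossing)
  then have sub: "S \<subseteq> chamb" by (simp add: crossing_def)
  consider X where "pg_point X" "\<forall>c\<in>S. X \<subseteq> lin c" | h where "pg_plane h" "\<forall>c\<in>S. lin c \<subseteq> h"
    | "card S \<le> 11 * q * (q + 1)\<^sup>2"
    using crossing_bound[OF F assms(1)] by blast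
  then show ?thesis
  proof cases
    case (1 X)
    then have "S \<subseteq> chambers_on X" using sub by (auto simp: chambers_on_point)
    then show ?thesis using 1 by blast
  next
    case (2 h)
    then have "S \<subseteq> chambers_on h" using sub by (auto simp: chambers_on_plane)
    then show ?thesis using 2 by blast
  qed simp
qed

lemma chromatic_number_chambers:
  assumes "q \<ge> 47"
  shows "chromatic_number (chambers :: 'a chamber set) opposite = q\<^sup>2 + q"
  unfolding chromatic_number_def
proof (rule Least_equality)
  obtain col :: "'a chamber \<Rightarrow> nat" where col: "\<forall>c\<in>chamb. col c < q\<^sup>2 + q"
    "\<forall>c\<in>chamb. \<forall>d\<in>chamb. col c = col d \<longrightarrow> meets (lin c) (lin d)"
    using colouring_exists by blast
  then have "proper_colouring (chambers :: 'a chamber set) opposite (q\<^sup>2 + q) col"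
    unfolding proper_colouring_def chambers_eq using opposite_iff by blast
  then show "\<exists>col. proper_colouring (chambers :: 'a chamber set) opposite (q\<^sup>2 + q) col" by blast
next
  fix k assume "\<exists>col. proper_colouring (chambers :: 'a chamber set) opposite k col"
  then obtain col where col: "\<And>c. c \<in> chamb \<Longrightarrow> col c < k"
    "\<And>c d. c \<in> chamb \<Longrightarrow> d \<in> chamb \<Longrightarrow> opposite c d \<Longrightarrow> col c \<noteq> col d"
    unfolding proper_colouring_def chambers_eq by blast
  have "crossing {c \<in> chamb. col c = i}" for i
    unfolding crossing_def using opposite_iff col(2) by blast
  then show "q\<^sup>2 + q \<le> k" using col(1) by (intro colours_lower_bound[OF assms])
qed

end

theorem theorem1p1:
  fixes q :: nat
  assumes q_def: "q = CARD('a::{field,finite})"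
    and q_ge: "q \<ge> 43"
  shows "{S. largest_independent_set (chambers :: 'a chamber set) opposite S} =
           {chambers_on x | x. pg_point x \<or> pg_plane x} \<and>
         (\<forall>S. maximal_independent_set (chambers :: 'a chamber set) opposite S \<and>
             \<not> (\<exists>x. (pg_point x \<or> pg_plane x) \<and> S = chambers_on x) \<longrightarrow>
           card S \<le> 9 * (q + 1) * (5 * q\<^sup>2 + 1)) \<and>
         (q \<ge> 47 \<longrightarrow>
           chromatic_number (chambers :: 'a chamber set) opposite = q\<^sup>2 + q)"
proof (intro conjI allI impI)
  let ?V = "chambers :: 'a chamber set"
  let ?N = "(q\<^sup>2 + q + 1) * (q + 1)\<^sup>2"
  note star = chambers_on_independent[OF q_def]
  note dichotomy = independent_set_dichotomy[OF q_def q_ge]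
  \<comment> \<open>Already for \<open>q \<ge> 11\<close> the bound for sets outside all stars is
    strictly below the size \<open>?N\<close> of a star.\<close>
  have le: "11 * q \<le> q * q" using q_ge by (intro mult_right_mono) auto
  then have "11 * q < q\<^sup>2 + q + 1" unfolding power2_eq_square by linarith
  then have less: "11 * q * (q + 1)\<^sup>2 < ?N" by (rule mult_strict_right_mono) simp
  have bound: "card T \<le> ?N" if "independent_set ?V opposite T" for T
    using dichotomy[OF that]
  proof
    assume "\<exists>x. (pg_point x \<or> pg_plane x) \<and> T \<subseteq> chambers_on x"
    then obtain x where x: "pg_point x \<or> pg_plane x" "T \<subseteq> chambers_on x" by blast
    then show ?thesis using card_mono[of "chambers_on x" T] star(2)[OF x(1)] by simp
  qed (use less in simp)
  \<comment> \<open>One actual star is needed to force a largest independent set to have at least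
    \<open>?N\<close> elements.\<close>
  define x0 where "x0 = vec.span {axis 1 1 :: 'a^4}"
  have "pg_point x0" unfolding x0_def by (rule span_singleton_point) (simp add: axis_eq_0_iff)
  then have x0: "pg_point x0 \<or> pg_plane x0" by simp
  show "{S. largest_independent_set ?V opposite S} = {chambers_on x | x. pg_point x \<or> pg_plane x}"
  proof (intro equalityI subsetI)
    fix S assume "S \<in> {S. largest_independent_set ?V opposite S}"
    then have S: "independent_set ?V opposite S"
      "\<And>T. independent_set ?V opposite T \<Longrightarrow> card T \<le> card S"
      by (auto simp: largest_independent_set_def)
    have ge: "?N \<le> card S" using S(2)[OF star(1)[OF x0]] star(2)[OF x0] by simp
    then have "\<not> card S \<le> 11 * q * (q + 1)\<^sup>2" using less by linarith
    then obtain x where x: "pg_point x \<or> pg_plane x" "S \<subseteq> chambers_on x"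
      using dichotomy[OF S(1)] by blast
    then have "S = chambers_on x" using card_seteq[of "chambers_on x" S] ge star(2)[OF x(1)] by simp
    then show "S \<in> {chambers_on x | x. pg_point x \<or> pg_plane x}" using x by blast
  next
    fix S :: "'a chamber set" assume "S \<in> {chambers_on x | x. pg_point x \<or> pg_plane x}"
    then obtain x where x: "pg_point x \<or> pg_plane x" "S = chambers_on x" by blast
    then show "S \<in> {S. largest_independent_set ?V opposite S}"
      using star[OF x(1)] bound by (simp add: largest_independent_set_def)
  qed
  show "card S \<le> 9 * (q + 1) * (5 * q\<^sup>2 + 1)"
    if S: "maximal_independent_set ?V opposite S \<and>
      \<not> (\<exists>x. (pg_point x \<or> pg_plane x) \<and> S = chambers_on x)" for S
  proof -
    have "card S \<le> 11 * q * (q + 1)\<^sup>2"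
    proof -
      have ind: "independent_set ?V opposite S"
        and max: "\<And>T. independent_set ?V opposite T \<Longrightarrow> S \<subseteq> T \<Longrightarrow> T = S"
        using S by (auto simp: maximal_independent_set_def)
      \<comment> \<open>A maximal set inside a star equals it, since the star is itself
        independent.\<close>
      have "\<not> (\<exists>x. (pg_point x \<or> pg_plane x) \<and> S \<subseteq> chambers_on x)" using max star(1) S by blast
      then show ?thesis using dichotomy[OF ind] by blast
    qed
    also have "\<dots> = (q + 1) * (11 * q * (q + 1))" by (simp add: power2_eq_square algebra_simps)
    also have "\<dots> \<le> (q + 1) * (9 * (5 * q\<^sup>2 + 1))"
    proof (rule mult_left_mono)
      have "11 * q * (q + 1) = 11 * (q * q) + 11 * q" by (simp add: algebra_simps)
      moreover have "9 * (5 * q\<^sup>2 + 1) = 45 * (q * q) + 9" by (simp add: power2_eq_square)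
      ultimately show "11 * q * (q + 1) \<le> 9 * (5 * q\<^sup>2 + 1)" using le q_ge by linarith
    qed simp
    finally show ?thesis by (simp add: algebra_simps)
  qed
  show "chromatic_number ?V opposite = q\<^sup>2 + q" if "q \<ge> 47"
    by (rule chromatic_number_chambers[OF q_def that])
qed

end
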